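(* Let $R>0$. Let $J$ satisfy: $J\in C(\mathbb{R})$, $J\ge 0$, $\int_{\mathbb{R}}J=1$, there exist $a<0<b$ with $J(a)>0$ and $J(b)>0$, and $J(x)=J(-x)$ for all $x\in\mathbb{R}$. Let $f:\mathbb{R}\times[0,\infty)\to\mathbb{R}$ satisfy: $f$ is continuous on $\mathbb{R}\times[0,\infty)$ and differentiable with respect to $u$; for each $u$, $f(\cdot,u)$ is periodic with period $2R$; $f_u(\cdot,0)$ is Lipschitz; $f(\cdot,0)\equiv 0$ and, for each $x$, $u\mapsto f(x,u)/u$ is (strictly) decreasing on $(0,\infty)$; and there exists $M>0$ such that $f(x,u)\le 0$ for all $u\ge M$ and all $x$. Let $\mathcal{M}[u]=J\star u-u$, let $u$ be a nonnegative, bounded solution of $$\mathcal{M}[u]+f(x,u)=0\quad\text{in }\mathbb{R},$$ and let $\lambda_1$ be the principal eigenvalue of the operator $-(\mathcal{M}+f_u(x,0))$ with $2R$-periodic boundary conditions. (a) If $\lambda_1<0$, then either $u\equiv 0$ or $u\equiv p$, where $p$ is the positive $2R$-periodic solution of the same equation (which exists when $\lambda_1<0$). (b) If $\lambda_1\ge 0$, then $u\equiv 0$.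
   Context: Convolution: $(J\star u)(x)=\int_{\mathbb{R}}J(x-y)u(y)\,dy$. Solutions of $\mathcal{M}[u]+f(x,u)=0$ are nonnegative bounded measurable functions satisfying the equation almost everywhere (they need not be continuous); equality of such functions is understood almost everywhere. Principal eigenvalue: let $C_{per}(\mathbb{R})$ be the space of continuous $2R$-periodic functions $\mathbb{R}\to\mathbb{R}$. For a Lipschitz $2R$-periodic function $a$, the principal eigenvalue of $-(\mathcal{M}+a(x))$ (with periodic boundary conditions, i.e. in $C_{per}(\mathbb{R})$) is the unique $\lambda_1\in\mathbb{R}$ for which there is a positive $\phi_1\in C_{per}(\mathbb{R})$ with $\mathcal{M}[\phi_1]+a(x)\phi_1=-\lambda_1\phi_1$ in $\mathbb{R}$. When $\lambda_1<0$ the equation has a nontrivial nonnegative bounded $2R$-periodic solution; $p$ denotes this solution. *)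

theory Defs
  imports "HOL-Analysis.Analysis"
begin

definition convolution :: "(real \<Rightarrow> real) \<Rightarrow> (real \<Rightarrow> real) \<Rightarrow> real \<Rightarrow> real" where
  "convolution J u x = (LINT y|lebesgue. J (x - y) * u y)"

definition dispersal :: "(real \<Rightarrow> real) \<Rightarrow> (real \<Rightarrow> real) \<Rightarrow> real \<Rightarrow> real" where
  "dispersal J u x = convolution J u x - u x"

definition periodic :: "real \<Rightarrow> (real \<Rightarrow> 'a) \<Rightarrow> bool" where
  "periodic T g \<longleftrightarrow> (\<forall>x. g (x + T) = g x)"

definition C_per :: "real \<Rightarrow> (real \<Rightarrow> real) set" where
  "C_per R = {g. continuous_on UNIV g \<and> periodic (2 * R) g}"

(* A predicate rather than a definite description: for Lipschitz 2R-periodic a there is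
   exactly one such lam, and it is the principal eigenvalue of -(dispersal J + a). *)
definition is_principal_eigenvalue ::
  "real \<Rightarrow> (real \<Rightarrow> real) \<Rightarrow> (real \<Rightarrow> real) \<Rightarrow> real \<Rightarrow> bool" where
  "is_principal_eigenvalue R J a lam \<longleftrightarrow>
     (\<exists>\<phi>\<in>C_per R. (\<forall>x. 0 < \<phi> x) \<and>
        (\<forall>x. dispersal J \<phi> x + a x * \<phi> x = - lam * \<phi> x))"

(* Solutions need not be continuous and satisfy the equation almost everywhere only.
   Nonnegativity is required pointwise because f x is only meaningful on {0..}. *)
definition nonneg_bounded_solution ::
  "(real \<Rightarrow> real) \<Rightarrow> (real \<Rightarrow> real \<Rightarrow> real) \<Rightarrow> (real \<Rightarrow> real) \<Rightarrow> bool" where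
  "nonneg_bounded_solution J f u \<longleftrightarrow>
     u \<in> borel_measurable lebesgue \<and> (\<forall>x. 0 \<le> u x) \<and> bounded (range u) \<and>
     (AE x in lebesgue. dispersal J u x + f x (u x) = 0)"

definition positive_periodic_solution ::
  "real \<Rightarrow> (real \<Rightarrow> real) \<Rightarrow> (real \<Rightarrow> real \<Rightarrow> real) \<Rightarrow> (real \<Rightarrow> real) \<Rightarrow> bool" where
  "positive_periodic_solution R J f p \<longleftrightarrow>
     nonneg_bounded_solution J f p \<and> periodic (2 * R) p \<and> (\<forall>x. 0 < p x)"

end

(* The equation reads J*u = u - f(x,u), so F(x,v) = f(x,v)/v, which decreases strictly from
   a(x) = f_u(x,0), satisfies 1 - F(x,u) = J*u / u.  Two functions u, v with inf v > 0 are compared at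
   points where u/v nearly attains its essential supremum S: there J*u / u is at most (1 + e) J*v / v.
   With v a positive multiple of the eigenfunction phi this gives (b); with v a solution and S > 1 it
   contradicts the strict monotonicity of F, so two solutions bounded away from 0 agree.

   The main point is that for lambda < 0 a nontrivial solution u has a positive lower bound.  As
   J*u / u - J*phi / phi = a - F(x,u) + lambda, integrating this against phi^2 over A = [z-n, z+n] and
   symmetrizing over A x A (Picone's identity; here J(x) = J(-x) enters) bounds the integral from
   below by -sup phi^2 times the J-mass jumping from A to its complement, which is o(n) uniformly in z
   without any moment assumption on J.  Hence a - F(x,u) is at least |lambda|/2 on average over long
   windows, so u has mass bounded below in every window of some fixed length, and finitely many jumps
   of J spread this mass into a pointwise lower bound.

   The periodic solution is the limit of the decreasing iteration p - f(x,p) = J*(previous p) started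
   at the constant M and kept above a small multiple of phi. *)
theory Submission
  imports Defs
begin

section \<open>Convolution with a symmetric kernel\<close>

text \<open>Borel rather than Lebesgue measurability, so that Fubini's theorem applies on products
  of \<open>lborel\<close>. The bounds hold pointwise, and solutions are replaced by such versions
  at the end.\<close>

definition profile :: "real \<Rightarrow> (real \<Rightarrow> real) \<Rightarrow> bool" where
  "profile B u \<longleftrightarrow> u \<in> borel_measurable borel \<and> (\<forall>x. 0 \<le> u x \<and> u x \<le> B)"

lemma profileD:
  assumes "profile B u"
  shows "u \<in> borel_measurable borel" "u x \<ge> 0" "u x \<le> B" "B \<ge> 0"
  using assms order_trans unfolding profile_def by blast+

lemma integrable_indicator_times_bounded:
  fixes g :: "'a \<Rightarrow> real"
  assumes "g \<in> borel_measurable M" "A \<in> sets M" "emeasure M A < \<infinity>"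
    and "\<And>x. x \<in> A \<Longrightarrow> \<bar>g x\<bar> \<le> C"
  shows "integrable M (\<lambda>x. indicator A x * g x)"
proof (rule Bochner_Integration.integrable_bound)
  show "integrable M (\<lambda>x. C * indicator A x)"
    using assms by simp
qed (use assms in \<open>force simp: indicator_def\<close>)+

locale dispersal_kernel =
  fixes J :: "real \<Rightarrow> real"
  assumes cont: "continuous_on UNIV J"
    and nonneg: "J x \<ge> 0"
    and integrable: "integrable lborel J"
    and mass: "(LINT x|lborel. J x) = 1"
    and sym: "J (- x) = J x"
begin

lemma measurable_J [measurable]: "J \<in> borel_measurable borel"
  using cont by (simp add: borel_measurable_continuous_onI)

lemma integrable_shift: "integrable lborel (\<lambda>y. J (x - y))"
  using lborel_integrable_real_affine[OF integrable, of "-1" x] by simp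

lemma integral_shift: "(LINT y|lborel. J (x - y)) = 1"
  using lborel_integral_real_affine[of "-1" J x] mass by simp

lemma integrable_profile:
  assumes "profile B u"
  shows "integrable lborel (\<lambda>y. J (x - y) * u y)"
proof (rule Bochner_Integration.integrable_bound)
  show "integrable lborel (\<lambda>y. B * J (x - y))"
    by (simp add: integrable_shift)
  show "(\<lambda>y. J (x - y) * u y) \<in> borel_measurable lborel"
    using profileD(1)[OF assms] by measurable
  show "AE y in lborel. norm (J (x - y) * u y) \<le> norm (B * J (x - y))"
    using profileD[OF assms] nonneg
    by (auto simp: abs_mult mult.commute intro!: AE_I2 mult_right_mono)
qed

lemma convolution_lborel:
  assumes "u \<in> borel_measurable borel"
  shows "convolution J u x = (LINT y|lborel. J (x - y) * u y)"
  unfolding convolution_def using assms by (intro integral_completion) measurable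

lemma convolution_measurable:
  assumes "profile B u"
  shows "convolution J u \<in> borel_measurable borel"
proof -
  note [measurable] = profileD(1)[OF assms]
  have "(\<lambda>x. LINT y|lborel. J (x - y) * u y) \<in> borel_measurable borel"
    by measurable
  then show ?thesis
    by (simp add: convolution_lborel[symmetric] cong: measurable_cong)
qed

lemma convolution_mono:
  assumes "profile B u" "profile B' v" "AE x in lborel. u x \<le> v x"
  shows "convolution J u x \<le> convolution J v x"
proof -
  have "(LINT y|lborel. J (x - y) * u y) \<le> (LINT y|lborel. J (x - y) * v y)"
    by (rule integral_mono_AE)
       (use assms nonneg integrable_profile in \<open>auto intro: mult_left_mono\<close>)
  then show ?thesis
    by (simp add: convolution_lborel profileD(1)[OF assms(1)] profileD(1)[OF assms(2)])
qed

lemma convolution_cong_AE: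
  assumes "profile B u" "profile B' v" "AE x in lborel. u x = v x"
  shows "convolution J u x = convolution J v x"
proof (rule antisym)
  show "convolution J u x \<le> convolution J v x" "convolution J v x \<le> convolution J u x"
    using assms(3) by (auto intro!: convolution_mono[OF assms(1,2)] convolution_mono[OF assms(2,1)]
      elim: eventually_mono)
qed

lemma convolution_cmult:
  assumes "profile B u"
  shows "convolution J (\<lambda>y. c * u y) x = c * convolution J u x"
proof -
  note [measurable] = profileD(1)[OF assms]
  have "(LINT y|lborel. J (x - y) * (c * u y)) = c * (LINT y|lborel. J (x - y) * u y)"
    by (simp add: mult.left_commute)
  then show ?thesis
    by (simp add: convolution_lborel)
qed

lemma convolution_const: "convolution J (\<lambda>_. c) x = c"
  by (simp add: convolution_lborel integral_shift)

lemma convolution_nonneg: "profile B u \<Longrightarrow> 0 \<le> convolution J u x"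
  by (simp add: convolution_lborel profileD nonneg)

lemma convolution_le:
  assumes "profile B u"
  shows "convolution J u x \<le> B"
  using convolution_mono[OF assms, of B "\<lambda>_. B" x] profileD[OF assms]
  by (simp add: convolution_const profile_def)

lemma convolution_shift:
  assumes "profile B u"
  shows "convolution J u (x + T) = convolution J (\<lambda>y. u (y + T)) x"
proof -
  note [measurable] = profileD(1)[OF assms]
  show ?thesis
    using lborel_integral_real_affine[of 1 "\<lambda>y. J (x + T - y) * u y" T]
    by (simp add: convolution_lborel algebra_simps)
qed

lemma convolution_tendsto:
  assumes "\<And>k. profile B (u k)" "\<And>x. (\<lambda>k. u k x) \<longlonglongrightarrow> v x"
  shows "(\<lambda>k. convolution J (u k) x) \<longlonglongrightarrow> convolution J v x"
proof -
  note [measurable] = profileD(1)[OF assms(1)]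
  have [measurable]: "v \<in> borel_measurable borel"
    by (rule borel_measurable_LIMSEQ_real[OF assms(2)]) simp_all
  have "(\<lambda>k. LINT y|lborel. J (x - y) * u k y) \<longlonglongrightarrow> (LINT y|lborel. J (x - y) * v y)"
  proof (rule integral_dominated_convergence)
    show "integrable lborel (\<lambda>y. B * J (x - y))"
      by (simp add: integrable_shift)
    show "AE y in lborel. (\<lambda>k. J (x - y) * u k y) \<longlonglongrightarrow> J (x - y) * v y"
      by (auto intro!: tendsto_intros assms)
    show "AE y in lborel. norm (J (x - y) * u k y) \<le> B * J (x - y)" for k
      using profileD[OF assms(1)] nonneg
      by (auto simp: abs_mult mult.commute intro!: AE_I2 mult_right_mono)
  qed measurable
  then show ?thesis
    by (simp add: convolution_lborel)
qed

section \<open>Escape of kernel mass from a long interval\<close>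

definition tail :: "real \<Rightarrow> real" where
  "tail L = (LINT t|lborel. indicator {t. L < \<bar>t\<bar>} t * J t)"

text \<open>Dominated convergence with majorant \<open>J\<close>: every fixed jump length is
  eventually exceeded by \<open>n\<close>.\<close>

lemma tail_tendsto_0: "(\<lambda>n. tail (real n)) \<longlonglongrightarrow> 0"
proof -
  have "(\<lambda>n. LINT t|lborel. indicator {t. real n < \<bar>t\<bar>} t * J t) \<longlonglongrightarrow> (LINT t::real|lborel. 0)"
  proof (rule integral_dominated_convergence)
    show "integrable lborel J" by (rule integrable)
    show "AE t in lborel. (\<lambda>n. indicator {t. real n < \<bar>t\<bar>} t * J t) \<longlonglongrightarrow> 0"
    proof (rule AE_I2)
      fix t :: real
      obtain N :: nat where "\<bar>t\<bar> \<le> real N" using real_arch_simple by blast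
      then have "eventually (\<lambda>n. indicator {t. real n < \<bar>t\<bar>} t * J t = 0) sequentially"
        by (intro eventually_sequentiallyI[of N]) (auto simp: indicator_def)
      then show "(\<lambda>n. indicator {t. real n < \<bar>t\<bar>} t * J t) \<longlonglongrightarrow> 0"
        by (rule tendsto_eventually)
    qed
    show "AE t in lborel. norm (indicator {t. real n < \<bar>t\<bar>} t * J t) \<le> J t" for n
      by (rule AE_I2) (auto simp: indicator_def nonneg)
  qed measurable
  then show ?thesis by (simp add: tail_def)
qed

lemma integrable_indicator_J: "A \<in> sets borel \<Longrightarrow> integrable lborel (\<lambda>t. indicator A t * J t)"
  using integrable_real_mult_indicator[of A lborel J] integrable by (simp add: mult.commute)

lemma integrable_indicator_shift:
  "A \<in> sets borel \<Longrightarrow> integrable lborel (\<lambda>y. indicator A y * J (x - y))"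
  using integrable_mult_indicator[of A lborel "\<lambda>y. J (x - y)"] integrable_shift
  by (simp only: real_scaleR_def sets_lborel)

lemma outside_le_1:
  assumes "A \<in> sets borel"
  shows "(LINT y|lborel. indicator A y * J (x - y)) \<le> 1"
proof -
  have "(LINT y|lborel. indicator A y * J (x - y)) \<le> (LINT y|lborel. J (x - y))"
    using assms nonneg
    by (intro integral_mono integrable_shift integrable_indicator_shift) (auto split: split_indicator)
  then show ?thesis by (simp add: integral_shift)
qed

text \<open>From a point lying deeper than \<open>L\<close> inside the interval, every jump that
  leaves the interval is longer than \<open>L\<close>.\<close>

lemma outside_le_tail:
  assumes "\<bar>x - z\<bar> < n - L"
  shows "(LINT y|lborel. indicator (- {z - n..z + n}) y * J (x - y)) \<le> tail L"
proof -
  have "(LINT y|lborel. indicator (- {z - n..z + n}) y * J (x - y))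
      \<le> (LINT y|lborel. indicator {t. L < \<bar>t\<bar>} (x - y) * J (x - y))"
  proof (rule integral_mono)
    show "integrable lborel (\<lambda>y. indicator (- {z - n..z + n}) y * J (x - y))"
      by (intro integrable_indicator_shift) auto
    have "integrable lborel (\<lambda>t. indicator {t. L < \<bar>t\<bar>} t * J t)"
      by (intro integrable_indicator_J) measurable
    from lborel_integrable_real_affine[OF this, of "-1" x]
    show "integrable lborel (\<lambda>y. indicator {t. L < \<bar>t\<bar>} (x - y) * J (x - y))" by simp
  qed (use assms in \<open>auto simp: indicator_def nonneg\<close>)
  also have "\<dots> = tail L"
    using lborel_integral_real_affine[of "-1" "\<lambda>t. indicator {t. L < \<bar>t\<bar>} t * J t" x]
    by (simp add: tail_def)
  finally show ?thesis .
qed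

text \<open>Each point deeper than \<open>L\<close> loses at most \<open>tail L\<close>, and the two
  boundary layers of width \<open>L\<close> lose at most 1 per unit length because \<open>J\<close>
  has mass 1. With \<open>L\<close> fixed first and \<open>n\<close> large afterwards, the loss is a
  small fraction of \<open>n\<close>, uniformly in \<open>z\<close>.\<close>

lemma flux_le:
  assumes "0 \<le> L" "L \<le> n"
  shows "(LINT x|lborel. indicator {z - n..z + n} x *
            (LINT y|lborel. indicator (- {z - n..z + n}) y * J (x - y)))
         \<le> 2 * n * tail L + 2 * L"
proof -
  let ?A = "{z - n..z + n}"
  let ?g = "\<lambda>x. LINT y|lborel. indicator (- ?A) y * J (x - y)"
  have g_nonneg: "?g x \<ge> 0" for x
    by (intro Bochner_Integration.integral_nonneg) (auto simp: nonneg)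
  have tail_nonneg: "tail L \<ge> 0"
    unfolding tail_def by (intro Bochner_Integration.integral_nonneg) (auto simp: nonneg)
  let ?I1 = "{z - n..z - n + L}" and ?I2 = "{z + n - L..z + n}"
  have "(LINT x|lborel. indicator ?A x * ?g x)
     \<le> (LINT x|lborel. tail L * indicator ?A x + indicator ?I1 x + indicator ?I2 x)"
  proof (rule integral_mono)
    show "integrable lborel (\<lambda>x. indicator ?A x * ?g x)"
      by (rule integrable_indicator_times_bounded[where C = 1])
         (use g_nonneg in \<open>auto intro!: outside_le_1 abs_leI simp: emeasure_lborel_Icc_eq
            intro: order_trans[of _ 0]\<close>)
    show "indicator ?A x * ?g x \<le> tail L * indicator ?A x + indicator ?I1 x + indicator ?I2 x" for x
    proof (cases "\<bar>x - z\<bar> < n - L")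
      case True
      with outside_le_tail[OF True] show ?thesis by (auto simp: indicator_def)
    next
      case False
      then have "x \<in> ?A \<Longrightarrow> x \<in> ?I1 \<or> x \<in> ?I2" by (auto simp: abs_if split: if_splits)
      moreover have "?g x \<le> 1" by (intro outside_le_1) auto
      ultimately show ?thesis using tail_nonneg by (auto simp: indicator_def)
    qed
    show "integrable lborel (\<lambda>x. tail L * indicator ?A x + indicator ?I1 x + indicator ?I2 x)"
      by (intro Bochner_Integration.integrable_add integrable_mult_right integrable_real_indicator)
         (auto simp: emeasure_lborel_Icc_eq)
  qed
  also have "\<dots> = 2 * n * tail L + 2 * L"
    using assms by (simp add: algebra_simps)
  finally show ?thesis .
qed


text \<open>Symmetrization over A x A, where A is the interval: the weighted ratios
  \<open>u y / u x\<close> and \<open>u x / u y\<close> together dominate the cross term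
  \<open>2 * (\<phi> x * \<phi> y)\<close>, and by symmetry of \<open>J\<close> both have the same
  integral. Jumps out of A are dropped from J*u, which has the favourable sign, and are paid for in
  J*\<phi> by \<Phi> squared times the flux.\<close>

lemma picone:
  assumes u: "profile B u" and \<phi>: "profile \<Phi> \<phi>"
    and c: "0 < c" "\<And>x. x \<in> {z - n..z + n} \<Longrightarrow> c \<le> u x"
  shows "- (\<Phi>\<^sup>2 * (LINT x|lborel. indicator {z - n..z + n} x *
            (LINT y|lborel. indicator (- {z - n..z + n}) y * J (x - y))))
    \<le> (LINT x|lborel. indicator {z - n..z + n} x *
          ((\<phi> x)\<^sup>2 * (convolution J u x / u x) - \<phi> x * convolution J \<phi> x))"
proof -
  let ?A = "{z - n..z + n}"
  note [measurable] = profileD(1)[OF u] profileD(1)[OF \<phi>]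
    convolution_measurable[OF u] convolution_measurable[OF \<phi>]
  note u_bd = profileD(2,3)[OF u] and \<phi>_bd = profileD(2,3)[OF \<phi>]
  have \<Phi>: "\<Phi> \<ge> 0" and B: "B \<ge> 0" using profileD(4) u \<phi> by auto
  have fin: "emeasure lborel ?A < \<infinity>" by (simp add: emeasure_lborel_Icc_eq)
  \<comment> \<open>\<open>K\<close> and \<open>H\<close> are the integrands of the two convolution
    terms, with both endpoints of the jump restricted to \<open>?A\<close>.\<close>
  define K where "K x y = indicator ?A x * indicator ?A y * J (x - y) * ((\<phi> x)\<^sup>2 * u y / u x)" for x y
  define H where "H x y = indicator ?A x * indicator ?A y * J (x - y) * (\<phi> x * \<phi> y)" for x y
  have [measurable]: "case_prod K \<in> borel_measurable (borel \<Otimes>\<^sub>M borel)"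
    "case_prod H \<in> borel_measurable (borel \<Otimes>\<^sub>M borel)"
    unfolding K_def H_def by measurable
  \<comment> \<open>Differences of points of \<open>?A\<close> stay in a compact interval, so
    \<open>J\<close> is bounded there. This makes \<open>K\<close> and \<open>H\<close> bounded
    functions on a set of finite product measure, hence integrable.\<close>
  obtain Jm where Jm: "\<And>t. t \<in> {- 2 * n..2 * n} \<Longrightarrow> J t \<le> Jm"
  proof -
    have "compact (J ` {- 2 * n..2 * n})"
      by (intro compact_continuous_image continuous_on_subset[OF cont]) auto
    then show ?thesis
      using that bounded_imp_bdd_above[OF compact_imp_bounded] by (metis bdd_above.E image_eqI)
  qed
  have Jm': "J (x - y) \<le> Jm" if "x \<in> ?A" "y \<in> ?A" for x y
    using that by (intro Jm) auto
  have K0: "0 \<le> K x y" and K1: "K x y \<le> J (x - y) * (\<Phi>\<^sup>2 * B / c)"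
    and H0: "0 \<le> H x y" and H1: "H x y \<le> J (x - y) * (\<Phi> * \<Phi>)" for x y
  proof -
    show "0 \<le> K x y" "0 \<le> H x y" using u_bd \<phi>_bd by (auto simp: K_def H_def nonneg)
    have "(\<phi> x)\<^sup>2 * u y / u x \<le> \<Phi>\<^sup>2 * B / c" if "x \<in> ?A"
      using u_bd \<phi>_bd c that B by (intro frac_le mult_mono power_mono) auto
    then show "K x y \<le> J (x - y) * (\<Phi>\<^sup>2 * B / c)"
      using B c by (auto simp: K_def indicator_def nonneg simp del: times_divide_eq_right intro!: mult_left_mono)
    have "\<phi> x * \<phi> y \<le> \<Phi> * \<Phi>" using \<phi>_bd \<Phi> by (intro mult_mono) auto
    then show "H x y \<le> J (x - y) * (\<Phi> * \<Phi>)"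
      using \<Phi> by (auto simp: H_def indicator_def nonneg intro!: mult_left_mono)
  qed
  have int2: "Bochner_Integration.integrable (lborel \<Otimes>\<^sub>M lborel) (case_prod G)"
    if [measurable]: "case_prod G \<in> borel_measurable (borel \<Otimes>\<^sub>M borel)"
      and G: "\<And>x y. 0 \<le> G x y" "\<And>x y. G x y \<le> J (x - y) * M" "M \<ge> 0"
        "\<And>x y. x \<notin> ?A \<or> y \<notin> ?A \<Longrightarrow> G x y = 0"
    for G :: "real \<Rightarrow> real \<Rightarrow> real" and M
  proof -
    have "Bochner_Integration.integrable (lborel \<Otimes>\<^sub>M lborel)
        (\<lambda>p. indicator (?A \<times> ?A) p * case_prod G p)"
    proof (rule integrable_indicator_times_bounded[where C = "Jm * M"])
      show "emeasure (lborel \<Otimes>\<^sub>M lborel) (?A \<times> ?A) < \<infinity>"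
        by (simp add: lborel.emeasure_pair_measure_Times emeasure_lborel_Icc_eq
            ennreal_mult_less_top)
      fix p assume "p \<in> ?A \<times> ?A"
      then show "\<bar>case_prod G p\<bar> \<le> Jm * M"
        using G(1)[of "fst p" "snd p"] G(2)[of "fst p" "snd p"] Jm'[of "fst p" "snd p"] G(3)
        by (auto intro!: order_trans[OF _ mult_right_mono[of _ Jm M]])
    qed (auto intro!: pair_measureI)
    also have "(\<lambda>p. indicator (?A \<times> ?A) p * case_prod G p) = case_prod G"
      using G(4) by (force simp: indicator_def)
    finally show ?thesis .
  qed
  have intK: "Bochner_Integration.integrable (lborel \<Otimes>\<^sub>M lborel) (case_prod K)"
    using B c K0 K1 by (intro int2[where M = "\<Phi>\<^sup>2 * B / c"]) (auto simp: K_def)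
  have intH: "Bochner_Integration.integrable (lborel \<Otimes>\<^sub>M lborel) (case_prod H)"
    using \<Phi> H0 H1 by (intro int2[where M = "\<Phi> * \<Phi>"]) (auto simp: H_def)
  have intK': "Bochner_Integration.integrable (lborel \<Otimes>\<^sub>M lborel) (\<lambda>(x, y). K y x)"
    using lborel_pair.integrable_product_swap[OF intK] by (simp add: case_prod_unfold)
  \<comment> \<open>Pointwise, the difference of the two sides is \<open>J (x - y)\<close> times a
    square over \<open>u x * u y\<close>. Since \<open>sym\<close> gives
    \<open>J (y - x) = J (x - y)\<close>, swapping the variables turns the second summand into
    \<open>K\<close>.\<close>
  have "(LINT p|(lborel \<Otimes>\<^sub>M lborel). 2 * case_prod H p)
      \<le> (LINT p|(lborel \<Otimes>\<^sub>M lborel). case_prod K p + (\<lambda>(x, y). K y x) p)"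
  proof (rule integral_mono)
    fix p :: "real \<times> real"
    obtain x y where p: "p = (x, y)" by fastforce
    have "2 * (\<phi> x * \<phi> y) \<le> (\<phi> x)\<^sup>2 * u y / u x + (\<phi> y)\<^sup>2 * u x / u y" if "x \<in> ?A" "y \<in> ?A"
    proof -
      have pos: "u x > 0" "u y > 0" using c(2)[OF that(1)] c(2)[OF that(2)] c(1) by auto
      have "(\<phi> x)\<^sup>2 * u y / u x + (\<phi> y)\<^sup>2 * u x / u y - 2 * (\<phi> x * \<phi> y)
          = (\<phi> x * u y - \<phi> y * u x)\<^sup>2 / (u x * u y)"
        using pos by (simp add: field_simps power2_eq_square)
      also have "\<dots> \<ge> 0" using pos by simp
      finally show ?thesis by simp
    qed
    from mult_left_mono[OF this nonneg[of "x - y"]]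
    show "2 * case_prod H p \<le> case_prod K p + (\<lambda>(x, y). K y x) p"
      using sym[of "x - y"] by (auto simp: p H_def K_def indicator_def algebra_simps)
  qed (use intK intK' intH in auto)
  also have "\<dots> = 2 * (LINT p|(lborel \<Otimes>\<^sub>M lborel). case_prod K p)"
    using intK intK' lborel_pair.integral_product_swap[of "case_prod K"]
    by (subst Bochner_Integration.integral_add) (auto simp: case_prod_unfold)
  finally have HK: "(LINT x|lborel. LINT y|lborel. H x y) \<le> (LINT x|lborel. LINT y|lborel. K x y)"
    using lborel_pair.integral_fst'[OF intK] lborel_pair.integral_fst'[OF intH] by simp
  let ?g = "\<lambda>x. LINT y|lborel. indicator (- ?A) y * J (x - y)"
  have g: "0 \<le> ?g x" "?g x \<le> 1" for x
    by (auto intro!: outside_le_1 Bochner_Integration.integral_nonneg simp: nonneg)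
  have intK_y: "Bochner_Integration.integrable lborel (K x)" for x
  proof (rule Bochner_Integration.integrable_bound)
    show "Bochner_Integration.integrable lborel (\<lambda>y. J (x - y) * (\<Phi>\<^sup>2 * B / c))"
      by (simp add: integrable_shift)
    show "AE y in lborel. norm (K x y) \<le> norm (J (x - y) * (\<Phi>\<^sup>2 * B / c))"
      using K0 K1 by (intro AE_I2) (smt (verit) real_norm_def)
  qed measurable
  have intH_y: "Bochner_Integration.integrable lborel (H x)" for x
  proof (rule Bochner_Integration.integrable_bound)
    show "Bochner_Integration.integrable lborel (\<lambda>y. J (x - y) * (\<Phi> * \<Phi>))"
      by (simp add: integrable_shift)
    show "AE y in lborel. norm (H x y) \<le> norm (J (x - y) * (\<Phi> * \<Phi>))"
      using H0 H1 by (intro AE_I2) (smt (verit) real_norm_def)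
  qed measurable
  \<comment> \<open>Jumps from \<open>?A\<close> to its complement contribute a nonnegative amount
    to J*u and can be discarded.\<close>
  have K_le: "(LINT y|lborel. K x y) \<le> indicator ?A x * ((\<phi> x)\<^sup>2 * (convolution J u x / u x))" for x
  proof -
    have "(LINT y|lborel. K x y)
        \<le> (LINT y|lborel. (indicator ?A x * (\<phi> x)\<^sup>2 / u x) * (J (x - y) * u y))"
    proof (rule integral_mono[OF intK_y])
      show "K x y \<le> indicator ?A x * (\<phi> x)\<^sup>2 / u x * (J (x - y) * u y)" for y
        using u_bd nonneg[of "x - y"] by (auto simp: K_def algebra_simps split: split_indicator)
    qed (intro integrable_mult_right integrable_profile[OF u])
    then show ?thesis by (simp add: convolution_lborel)
  qed
  \<comment> \<open>Here the jumps to the complement must be kept; each is bounded using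
    \<open>\<phi> x * \<phi> y \<le> \<Phi>\<^sup>2\<close>.\<close>
  have H_ge: "indicator ?A x * (\<phi> x * convolution J \<phi> x) \<le> (LINT y|lborel. H x y) + \<Phi>\<^sup>2 * (indicator ?A x * ?g x)"
    for x
  proof -
    have "(LINT y|lborel. (indicator ?A x * \<phi> x) * (J (x - y) * \<phi> y))
      \<le> (LINT y|lborel. H x y + \<Phi>\<^sup>2 * (indicator ?A x * (indicator (- ?A) y * J (x - y))))"
    proof (rule integral_mono)
      fix y
      have "\<phi> x * \<phi> y \<le> \<Phi>\<^sup>2"
        using \<phi>_bd \<Phi> by (auto simp: power2_eq_square intro!: mult_mono)
      from mult_left_mono[OF this nonneg[of "x - y"]]
      show "(indicator ?A x * \<phi> x) * (J (x - y) * \<phi> y)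
          \<le> H x y + \<Phi>\<^sup>2 * (indicator ?A x * (indicator (- ?A) y * J (x - y)))"
        by (auto simp: H_def indicator_def algebra_simps)
    qed (use intH_y integrable_profile[OF \<phi>] in
          \<open>auto intro!: integrable_mult_right integrable_indicator_shift Bochner_Integration.integrable_add\<close>)
    also have "\<dots> = (LINT y|lborel. H x y) + \<Phi>\<^sup>2 * (indicator ?A x * ?g x)"
      using intH_y
      by (subst Bochner_Integration.integral_add)
        (auto intro!: integrable_mult_right integrable_indicator_shift)
    finally show ?thesis by (simp add: convolution_lborel mult.assoc)
  qed
  have int1: "Bochner_Integration.integrable lborel (\<lambda>x. indicator ?A x * g' x)"
    if "g' \<in> borel_measurable borel" "\<And>x. x \<in> ?A \<Longrightarrow> \<bar>g' x\<bar> \<le> C" for g' and C :: real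
    using that fin by (intro integrable_indicator_times_bounded) auto
  have i1: "Bochner_Integration.integrable lborel (\<lambda>x. indicator ?A x * ((\<phi> x)\<^sup>2 * (convolution J u x / u x)))"
  proof (rule int1[where C = "\<Phi>\<^sup>2 * (B / c)"])
    fix x assume "x \<in> ?A"
    then show "\<bar>(\<phi> x)\<^sup>2 * (convolution J u x / u x)\<bar> \<le> \<Phi>\<^sup>2 * (B / c)"
      using u_bd \<phi>_bd c B convolution_nonneg[OF u] convolution_le[OF u]
      by (auto simp: abs_mult intro!: mult_mono power_mono frac_le)
  qed measurable
  have i2: "Bochner_Integration.integrable lborel (\<lambda>x. indicator ?A x * (\<phi> x * convolution J \<phi> x))"
  proof (rule int1[where C = "\<Phi> * \<Phi>"])
    fix x assume "x \<in> ?A"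
    then show "\<bar>\<phi> x * convolution J \<phi> x\<bar> \<le> \<Phi> * \<Phi>"
      using \<phi>_bd \<Phi> convolution_nonneg[OF \<phi>] convolution_le[OF \<phi>]
      by (auto simp: abs_mult intro!: mult_mono)
  qed measurable
  have i3: "Bochner_Integration.integrable lborel (\<lambda>x. indicator ?A x * ?g x)"
    using g by (intro int1[where C = 1]) auto
  have i4: "Bochner_Integration.integrable lborel (\<lambda>x. LINT y|lborel. H x y)"
    "Bochner_Integration.integrable lborel (\<lambda>x. LINT y|lborel. K x y)"
    using lborel_pair.integrable_fst'[OF intH] lborel_pair.integrable_fst'[OF intK] by simp_all
  have "(LINT x|lborel. indicator ?A x * (\<phi> x * convolution J \<phi> x))
      \<le> (LINT x|lborel. (LINT y|lborel. H x y) + \<Phi>\<^sup>2 * (indicator ?A x * ?g x))"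
    using i2 i3 i4 H_ge by (intro integral_mono) auto
  also have "\<dots> = (LINT x|lborel. LINT y|lborel. H x y) + \<Phi>\<^sup>2 * (LINT x|lborel. indicator ?A x * ?g x)"
    using i3 i4 by (subst Bochner_Integration.integral_add) auto
  also have "\<dots> \<le> (LINT x|lborel. indicator ?A x * ((\<phi> x)\<^sup>2 * (convolution J u x / u x)))
      + \<Phi>\<^sup>2 * (LINT x|lborel. indicator ?A x * ?g x)"
    using HK integral_mono[OF i4(2) i1 K_le] by simp
  finally show ?thesis
    using i1 i2 by (simp add: right_diff_distrib)
qed

lemma convolution_ge_integral:
  assumes u: "profile B u" and "\<And>y. y \<in> {p..q} \<Longrightarrow> j \<le> J (x - y)"
  shows "j * (LINT y|lborel. indicator {p..q} y * u y) \<le> convolution J u x"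
proof -
  have "(LINT y|lborel. j * (indicator {p..q} y * u y)) \<le> (LINT y|lborel. J (x - y) * u y)"
  proof (rule integral_mono)
    show "Bochner_Integration.integrable lborel (\<lambda>y. j * (indicator {p..q} y * u y))"
      using profileD[OF u]
      by (intro integrable_mult_right integrable_indicator_times_bounded[where C = B])
         (auto simp: emeasure_lborel_Icc_eq)
    show "j * (indicator {p..q} y * u y) \<le> J (x - y) * u y" for y
      using assms(2)[of y] profileD[OF u] nonneg
      by (auto simp: mult_right_mono split: split_indicator)
  qed (rule integrable_profile[OF u])
  then show ?thesis
    using profileD(1)[OF u] by (simp add: convolution_lborel)
qed

end

section \<open>Mass on intervals and its spreading by jumps\<close>

lemma integrable_interval_profile:
  "profile B u \<Longrightarrow> integrable lborel (\<lambda>x. indicator {p..q} x * u x)"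
  using profileD[of B u]
  by (intro integrable_indicator_times_bounded[where C = B]) (auto simp: emeasure_lborel_Icc_eq)

lemma integral_interval_nonneg:
  "profile B u \<Longrightarrow> 0 \<le> (LINT x|lborel. indicator {p..q} x * u x)"
  using profileD[of B u] by (intro Bochner_Integration.integral_nonneg) auto

lemma integral_interval_ge:
  assumes "profile B u" "p \<le> q" "AE x in lborel. x \<in> {p..q} \<longrightarrow> m \<le> u x"
  shows "(q - p) * m \<le> (LINT x|lborel. indicator {p..q} x * u x)"
proof -
  have "(LINT x|lborel. m * indicator {p..q} x) \<le> (LINT x|lborel. indicator {p..q} x * u x)"
  proof (rule integral_mono_AE)
    show "AE x in lborel. m * indicator {p..q} x \<le> indicator {p..q} x * u x"
      using assms(3) by eventually_elim (auto simp: indicator_def)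
  qed (use assms in \<open>auto intro: integrable_interval_profile simp: emeasure_lborel_Icc_eq\<close>)
  then show ?thesis using assms(2) by (simp add: mult.commute)
qed

text \<open>The radius \<open>2 * r\<close> leaves room for two errors of size \<open>r\<close>: a
  source within \<open>r\<close> of \<open>x0\<close> and a target within \<open>r\<close> of
  \<open>x0 + b\<close> are joined by a jump within \<open>2 * r\<close> of
  \<open>b\<close>.\<close>

locale spreading_kernel = dispersal_kernel +
  fixes b r j :: real
  assumes r: "0 < r" and j: "0 < j" and J_ge: "\<bar>t - b\<bar> \<le> 2 * r \<Longrightarrow> j \<le> J t"
begin

lemma J_ge': "\<bar>t + b\<bar> \<le> 2 * r \<Longrightarrow> j \<le> J t"
  using J_ge[of "- t"] sym[of t] by auto

abbreviation window :: "(real \<Rightarrow> real) \<Rightarrow> real \<Rightarrow> real" where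
  "window u x \<equiv> (LINT y|lborel. indicator {x - r..x + r} y * u y)"

text \<open>Two jumps, by \<open>b\<close> and back by \<open>- b\<close>, spread the mass of \<open>u\<close> over a larger interval.\<close>

lemma local_lower_bound:
  assumes u: "profile B u" and C: "C > 0" and super: "AE x in lborel. convolution J u x \<le> C * u x"
  shows "AE x in lborel. \<bar>x - x0\<bar> \<le> 2 * r \<longrightarrow> r * j\<^sup>2 / C\<^sup>2 * window u x0 \<le> u x"
proof -
  have "j * window u x0 \<le> convolution J u x" if "\<bar>x - (x0 + b)\<bar> \<le> r" for x
    using that by (intro convolution_ge_integral[OF u] J_ge) auto
  then have step: "AE x in lborel. \<bar>x - (x0 + b)\<bar> \<le> r \<longrightarrow> j * window u x0 / C \<le> u x"
    using super C by (auto elim!: eventually_mono simp: field_simps intro: order_trans)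
  have "r * j\<^sup>2 / C * window u x0 \<le> convolution J u x" if x: "\<bar>x - x0\<bar> \<le> 2 * r" for x
  proof -
    \<comment> \<open>The half of the interval around \<open>x0 + b\<close> on the same side as
      \<open>x\<close>. For \<open>y\<close> in it, \<open>x - y\<close> stays within
      \<open>2 * r\<close> of \<open>- b\<close> even when \<open>x\<close> is at distance
      \<open>2 * r\<close> from \<open>x0\<close>; using the full interval would allow
      \<open>3 * r\<close>.\<close>
    define p where "p = (if x0 \<le> x then x0 + b else x0 + b - r)"
    have "j * ((p + r - p) * (j * window u x0 / C))
        \<le> j * (LINT y|lborel. indicator {p..p + r} y * u y)"
    proof (intro mult_left_mono integral_interval_ge[OF u])
      show "AE y in lborel. y \<in> {p..p + r} \<longrightarrow> j * window u x0 / C \<le> u y"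
        using step by eventually_elim (auto simp: p_def abs_le_iff split: if_splits)
    qed (use j r in auto)
    also have "\<dots> \<le> convolution J u x"
      using x r by (intro convolution_ge_integral[OF u] J_ge') (auto simp: p_def split: if_splits)
    finally show ?thesis by (simp add: power2_eq_square algebra_simps)
  qed
  then have "\<bar>x - x0\<bar> \<le> 2 * r \<Longrightarrow> r * j\<^sup>2 / C * window u x0 / C \<le> convolution J u x / C" for x
    using C by (intro divide_right_mono) auto
  moreover have "AE x in lborel. convolution J u x / C \<le> u x"
    using super by eventually_elim (use C in \<open>simp add: field_simps\<close>)
  ultimately show ?thesis
    by (auto elim!: eventually_mono simp: power2_eq_square intro: order_trans)
qed

text \<open>The window at \<open>x1\<close> lies within \<open>2 * r\<close> of \<open>x0\<close>,
  so the pointwise bound there can be integrated over it. The gain from radius \<open>r\<close> to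
  \<open>2 * r\<close> is what allows the centre to move.\<close>

lemma window_step:
  assumes u: "profile B u" and C: "C > 0" and super: "AE x in lborel. convolution J u x \<le> C * u x"
    and x: "\<bar>x1 - x0\<bar> \<le> r"
  shows "2 * r\<^sup>2 * j\<^sup>2 / C\<^sup>2 * window u x0 \<le> window u x1"
proof -
  have "(x1 + r - (x1 - r)) * (r * j\<^sup>2 / C\<^sup>2 * window u x0) \<le> window u x1"
  proof (rule integral_interval_ge[OF u])
    show "AE x in lborel. x \<in> {x1 - r..x1 + r} \<longrightarrow> r * j\<^sup>2 / C\<^sup>2 * window u x0 \<le> u x"
      using local_lower_bound[OF u C super, of x0] by eventually_elim (use x in \<open>auto simp: abs_le_iff\<close>)
  qed (use r in auto)
  then show ?thesis by (simp add: power2_eq_square algebra_simps)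
qed

lemma window_chain:
  assumes u: "profile B u" and C: "C > 0" and super: "AE x in lborel. convolution J u x \<le> C * u x"
    and "\<bar>x1 - x0\<bar> \<le> real N * r"
  shows "(2 * r\<^sup>2 * j\<^sup>2 / C\<^sup>2) ^ N * window u x0 \<le> window u x1"
  using assms(4)
proof (induction N arbitrary: x1)
  case 0
  then show ?case by simp
next
  case (Suc N)
  \<comment> \<open>The point dividing the segment from \<open>x0\<close> to \<open>x1\<close> in
    the ratio N : 1. It is within \<open>N * r\<close> of \<open>x0\<close>, for the induction
    hypothesis, and within \<open>r\<close> of \<open>x1\<close>, for one more step.\<close>
  define y where "y = x0 + (x1 - x0) * (real N / real (Suc N))"
  have 1: "y - x0 = (x1 - x0) * (real N / real (Suc N))" by (simp add: y_def)
  have 2: "x1 - y = (x1 - x0) / real (Suc N)" by (simp add: y_def field_simps)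
  have "\<bar>y - x0\<bar> = \<bar>x1 - x0\<bar> * (real N / real (Suc N))"
    unfolding 1 by (simp add: abs_mult)
  also have "\<dots> \<le> (real (Suc N) * r) * (real N / real (Suc N))"
    using Suc.prems by (intro mult_right_mono) auto
  also have "\<dots> = real N * r" by (simp add: field_simps del: of_nat_Suc)
  finally have y0: "\<bar>y - x0\<bar> \<le> real N * r" .
  have y1: "\<bar>x1 - y\<bar> \<le> r"
    unfolding 2 using Suc.prems by (simp add: field_simps)
  let ?k = "2 * r\<^sup>2 * j\<^sup>2 / C\<^sup>2"
  have "?k ^ Suc N * window u x0 \<le> ?k * window u y"
    using mult_left_mono[OF Suc.IH[OF y0], of ?k] by (simp add: mult.assoc)
  also have "\<dots> \<le> window u x1"
    by (rule window_step[OF u C super y1])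
  finally show ?case .
qed

end

lemma (in dispersal_kernel) spreading:
  assumes "J b > 0"
  obtains r j where "spreading_kernel J b r j"
proof -
  have "isCont J b" using cont by (simp add: continuous_on_eq_continuous_at)
  from continuous_at_real_range[THEN iffD1, OF this, rule_format, of "J b / 2"] assms
  obtain d where d: "d > 0" "\<And>t. \<bar>t - b\<bar> < d \<Longrightarrow> \<bar>J t - J b\<bar> < J b / 2"
    by auto
  have "J b / 2 \<le> J t" if "\<bar>t - b\<bar> \<le> 2 * (d / 4)" for t
    using d(2)[of t] that d(1) unfolding abs_less_iff by linarith
  then show ?thesis
    using assms d(1) by (intro that[of "d / 4" "J b / 2"]) (unfold_locales, auto)
qed

section \<open>The reaction term\<close>

lemma periodic_int:
  assumes "periodic T g"
  shows "g (x + of_int k * T) = g x"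
proof -
  have *: "g (x + real n * T) = g x" for n x
  proof (induction n)
    case (Suc n)
    have "g (x + real (Suc n) * T) = g (x + real n * T + T)" by (simp add: algebra_simps)
    also have "\<dots> = g x" using assms Suc unfolding periodic_def by simp
    finally show ?case .
  qed simp
  show ?thesis
  proof (cases "k \<ge> 0")
    case True
    then show ?thesis using *[of x "nat k"] by simp
  next
    case False
    then show ?thesis using *[of "x + of_int k * T" "nat (- k)"] by simp
  qed
qed

lemma period_representative:
  fixes T x :: real
  assumes "T > 0"
  obtains y k where "y \<in> {0..T}" "x = y + of_int k * T"
proof
  have "of_int \<lfloor>x / T\<rfloor> \<le> x / T" "x / T \<le> of_int \<lfloor>x / T\<rfloor> + 1" by linarith+
  then have "of_int \<lfloor>x / T\<rfloor> * T \<le> x" "x \<le> (of_int \<lfloor>x / T\<rfloor> + 1) * T"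
    using assms by (simp_all only: pos_le_divide_eq pos_divide_le_eq)
  then show "x - of_int \<lfloor>x / T\<rfloor> * T \<in> {0..T}"
    by (simp add: algebra_simps)
  show "x = (x - of_int \<lfloor>x / T\<rfloor> * T) + of_int \<lfloor>x / T\<rfloor> * T" by simp
qed

text \<open>Periodicity reduces \<open>x\<close> to one compact period, and on its product with
  \<open>K\<close> the minimum is attained and hence positive. This is how strict pointwise
  inequalities become uniform below.\<close>

lemma periodic_lower_bound:
  fixes g :: "real \<Rightarrow> 'b::topological_space \<Rightarrow> real"
  assumes T: "T > 0" and K: "compact K"
    and g: "continuous_on (UNIV \<times> K) (\<lambda>(x, v). g x v)"
    and per: "\<And>v. v \<in> K \<Longrightarrow> periodic T (\<lambda>x. g x v)"
    and pos: "\<And>x v. v \<in> K \<Longrightarrow> g x v > 0"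
  obtains d where "d > 0" "\<And>x v. v \<in> K \<Longrightarrow> d \<le> g x v"
proof (cases "K = {}")
  case False
  have "compact ({0..T} \<times> K)" "{0..T} \<times> K \<noteq> {}"
    using T K False by (auto intro: compact_Times)
  moreover have "continuous_on ({0..T} \<times> K) (\<lambda>(x, v). g x v)"
    using g by (rule continuous_on_subset) auto
  ultimately obtain p where p: "p \<in> {0..T} \<times> K" "\<And>q. q \<in> {0..T} \<times> K \<Longrightarrow> case_prod g p \<le> case_prod g q"
    using continuous_attains_inf[of "{0..T} \<times> K" "case_prod g"] by blast
  show ?thesis
  proof
    show "case_prod g p > 0" using p(1) pos by auto
    fix x v assume v: "v \<in> K"
    obtain y k where y: "y \<in> {0..T}" "x = y + of_int k * T" using period_representative[OF T] .
    have "g x v = g y v" using periodic_int[OF per[OF v], of y k] y by simp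
    then show "case_prod g p \<le> g x v" using p(2)[of "(y, v)"] y v by simp
  qed
qed (use that[of 1] in auto)

lemma periodic_upper_bound:
  fixes g :: "real \<Rightarrow> real"
  assumes T: "T > 0" and g: "continuous_on UNIV g" "periodic T g"
  obtains C where "C > 0" "\<And>x. \<bar>g x\<bar> \<le> C"
proof -
  have "compact (g ` {0..T})"
    by (intro compact_continuous_image continuous_on_subset[OF g(1)]) auto
  then obtain C where C: "\<And>y. y \<in> {0..T} \<Longrightarrow> \<bar>g y\<bar> \<le> C"
    using compact_imp_bounded bounded_iff by (metis imageI real_norm_def)
  show ?thesis
  proof
    show "max C 1 > 0" by simp
    fix x
    obtain y k where y: "y \<in> {0..T}" "x = y + of_int k * T" using period_representative[OF T] .
    then have "g x = g y" using periodic_int[OF g(2), of y k] by simp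
    then show "\<bar>g x\<bar> \<le> max C 1" using C[OF y(1)] by simp
  qed
qed

section \<open>The per capita growth rate and its monotonicity\<close>

locale kpp_reaction =
  fixes R :: real and f fu :: "real \<Rightarrow> real \<Rightarrow> real"
  assumes R: "R > 0"
    and f_cont: "continuous_on (UNIV \<times> {0..}) (\<lambda>(x, v). f x v)"
    and f_deriv: "\<And>x. (f x has_real_derivative fu x 0) (at 0 within {0..})"
    and f_periodic: "\<And>v. v \<ge> 0 \<Longrightarrow> periodic (2 * R) (\<lambda>x. f x v)"
    and fu_cont: "continuous_on UNIV (\<lambda>x. fu x 0)"
    and f_zero: "\<And>x. f x 0 = 0"
    and f_decreasing: "\<And>x v w. 0 < v \<Longrightarrow> v < w \<Longrightarrow> f x w / w < f x v / v"
begin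

lemma rate_tendsto: "((\<lambda>v. f x v / v) \<longlongrightarrow> fu x 0) (at_right 0)"
proof -
  have "((\<lambda>v. (f x v - f x 0) / (v - 0)) \<longlongrightarrow> fu x 0) (at 0 within {0..})"
    using f_deriv[of x] by (simp add: has_field_derivative_iff)
  then have "((\<lambda>v. f x v / v) \<longlongrightarrow> fu x 0) (at 0 within {0..})"
    by (simp add: f_zero)
  then show ?thesis by (rule tendsto_within_subset) auto
qed

text \<open>The quotients \<open>f x v / v\<close> are periodic in \<open>x\<close>, and their limit
  at 0 is unique.\<close>

lemma fu_periodic: "periodic (2 * R) (\<lambda>x. fu x 0)"
  unfolding periodic_def
proof
  fix x
  have "((\<lambda>v. f (x + 2 * R) v / v) \<longlongrightarrow> fu x 0) (at_right 0)"
    using rate_tendsto[of x]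
  proof (rule Lim_transform_eventually)
    show "\<forall>\<^sub>F v in at_right 0. f x v / v = f (x + 2 * R) v / v"
      using f_periodic by (auto simp: eventually_at_filter periodic_def)
  qed
  then show "fu (x + 2 * R) 0 = fu x 0"
    using rate_tendsto[of "x + 2 * R"] tendsto_unique trivial_limit_at_right_real by blast
qed

lemma f_continuous:
  assumes "continuous_on S g" "continuous_on S h" "\<And>x. x \<in> S \<Longrightarrow> 0 \<le> h x"
  shows "continuous_on S (\<lambda>x. f (g x) (h x))"
  using continuous_on_compose2[OF f_cont, of S "\<lambda>x. (g x, h x)"] assms
  by (auto intro: continuous_on_Pair)

text \<open>The loss of per capita growth rate caused by density \<open>v\<close>, measured against
  the rate at density zero.\<close>

definition deficit :: "real \<Rightarrow> real \<Rightarrow> real" where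
  "deficit x v = fu x 0 - f x v / v"

lemma deficit_strict_mono: "0 < v \<Longrightarrow> v < w \<Longrightarrow> deficit x v < deficit x w"
  using f_decreasing[of v w x] by (simp add: deficit_def)

lemma deficit_mono: "0 < v \<Longrightarrow> v \<le> w \<Longrightarrow> deficit x v \<le> deficit x w"
  using deficit_strict_mono[of v w x] by (cases "v = w") auto

text \<open>A limit of strict inequalities gives only a weak one, here at \<open>v / 2\<close>; the
  strict decrease from \<open>v / 2\<close> to \<open>v\<close> restores strictness.\<close>

lemma deficit_pos:
  assumes "v > 0"
  shows "deficit x v > 0"
proof -
  have "f x (v / 2) / (v / 2) \<le> fu x 0"
  proof (rule tendsto_lowerbound[OF rate_tendsto])
    show "\<forall>\<^sub>F w in at_right 0. f x (v / 2) / (v / 2) \<le> f x w / w"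
      using assms f_decreasing[of _ "v / 2" x]
      by (auto simp: eventually_at_right_field intro!: exI[of _ "v / 2"] less_imp_le)
  qed simp
  then show ?thesis
    using f_decreasing[of "v / 2" v x] assms by (simp add: deficit_def)
qed

lemma deficit_periodic: "v \<ge> 0 \<Longrightarrow> periodic (2 * R) (\<lambda>x. deficit x v)"
  using f_periodic[of v] fu_periodic by (simp add: periodic_def deficit_def)

lemma rate_continuous:
  assumes "continuous_on S g" "continuous_on S h" "\<And>x. x \<in> S \<Longrightarrow> 0 < h x"
  shows "continuous_on S (\<lambda>x. f (g x) (h x) / h x)"
  by (intro continuous_on_divide f_continuous assms)
     (use assms(3) in \<open>auto intro: less_imp_le simp: less_imp_neq[symmetric]\<close>)

lemma deficit_continuous: "0 < v \<Longrightarrow> continuous_on UNIV (\<lambda>x. deficit x v)"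
  unfolding deficit_def by (intro continuous_on_diff fu_cont rate_continuous continuous_intros)

text \<open>Dini's argument.\<close>

lemma deficit_small:
  assumes "\<eta> > 0"
  obtains \<delta> where "\<delta> > 0" "\<And>x v. 0 < v \<Longrightarrow> v \<le> \<delta> \<Longrightarrow> deficit x v \<le> \<eta>"
proof -
  define U where "U n = {x. deficit x (1 / real (Suc n)) < \<eta>}" for n
  have "open (U n)" for n
    unfolding U_def by (intro open_Collect_less deficit_continuous continuous_on_const) simp
  moreover have "\<exists>n. x \<in> U n" for x
  proof -
    have "((\<lambda>v. deficit x v) \<longlongrightarrow> fu x 0 - fu x 0) (at_right 0)"
      unfolding deficit_def by (intro tendsto_intros rate_tendsto)
    from order_tendstoD(2)[OF this, of \<eta>] assms
    obtain d where d: "d > 0" "\<And>v. 0 < v \<Longrightarrow> v < d \<Longrightarrow> deficit x v < \<eta>"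
      by (auto simp: eventually_at_right_field)
    obtain n where "1 / real (Suc n) < d"
      using d(1) nat_approx_posE by blast
    with d(2)[of "1 / real (Suc n)"] show ?thesis by (auto simp: U_def)
  qed
  ultimately obtain F where F: "finite F" "{0..2 * R} \<subseteq> (\<Union>n\<in>F. U n)"
    using compactE_image[of "{0..2 * R}" UNIV U] by (metis UNIV_I UN_I compact_Icc subsetI)
  then obtain N where N: "\<And>n. n \<in> F \<Longrightarrow> n \<le> N"
    by (metis finite_nat_set_iff_bounded_le)
  show ?thesis
  proof
    show "1 / real (Suc N) > 0" by simp
    fix x v :: real assume v: "0 < v" "v \<le> 1 / real (Suc N)"
    obtain y k where y: "y \<in> {0..2 * R}" "x = y + of_int k * (2 * R)"
      using period_representative[of "2 * R"] R by auto
    then obtain n where n: "n \<in> F" "y \<in> U n" using F(2) by auto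
    have "v \<le> 1 / real (Suc n)"
      using v(2) N[OF n(1)] by (elim order_trans) (simp add: frac_le)
    then have "deficit y v \<le> \<eta>"
      using deficit_mono[OF v(1), of "1 / real (Suc n)" y] n(2) by (simp add: U_def)
    moreover have "deficit x v = deficit y v"
      using periodic_int[OF deficit_periodic, of v y k] v(1) y by simp
    ultimately show "deficit x v \<le> \<eta>" by simp
  qed
qed

lemma deficit_bounded:
  assumes "B > 0"
  obtains D where "D > 0" "\<And>x v. 0 < v \<Longrightarrow> v \<le> B \<Longrightarrow> deficit x v \<le> D"
proof -
  obtain D where D: "D > 0" "\<And>x. \<bar>deficit x B\<bar> \<le> D"
    using periodic_upper_bound[of "2 * R" "\<lambda>x. deficit x B"]
      deficit_continuous[of B] deficit_periodic[of B] R assms by auto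
  have "deficit x v \<le> D" if "0 < v" "v \<le> B" for x v
    using D(2)[of x] deficit_mono[OF that, of x] by linarith
  with D(1) show ?thesis by (rule that)
qed

text \<open>Small densities cost at most \<eta>, and for \<open>v > d\<close> a constant bound on
  the deficit is at most a multiple of \<open>v\<close>. Linearity in \<open>v\<close> lets
  integration turn the deficit into the mass of \<open>u\<close>.\<close>

lemma deficit_affine_bound:
  assumes "\<eta> > 0" "B > 0"
  obtains D where "D > 0" "\<And>x v. 0 < v \<Longrightarrow> v \<le> B \<Longrightarrow> deficit x v \<le> \<eta> + D * v"
proof -
  obtain d where d: "d > 0" "\<And>x v. 0 < v \<Longrightarrow> v \<le> d \<Longrightarrow> deficit x v \<le> \<eta>"
    using deficit_small[OF assms(1)] by blast
  obtain D where D: "D > 0" "\<And>x v. 0 < v \<Longrightarrow> v \<le> B \<Longrightarrow> deficit x v \<le> D"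
    using deficit_bounded[OF assms(2)] by blast
  have "deficit x v \<le> \<eta> + D / d * v" if v: "0 < v" "v \<le> B" for x v
  proof (cases "v \<le> d")
    case True
    then show ?thesis using d v D by (intro add_increasing2) auto
  next
    case False
    then have "D \<le> D / d * v" using d D by (simp add: field_simps)
    then show ?thesis using D(2)[OF v, of x] assms(1) by linarith
  qed
  then show ?thesis using that[of "D / d"] D d by auto
qed

text \<open>By monotonicity in \<open>v\<close> the worst case is \<open>v = s\<close>, where
  continuity and periodicity in \<open>x\<close> give a positive minimum.\<close>

lemma deficit_lower_bound:
  assumes "s > 0"
  obtains d where "d > 0" "\<And>x v. s \<le> v \<Longrightarrow> d \<le> deficit x v"
proof -
  have "continuous_on (UNIV \<times> {s}) (\<lambda>(x, v). deficit x v)"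
    using assms fu_cont unfolding deficit_def case_prod_unfold
    by (intro continuous_on_diff rate_continuous continuous_intros
        continuous_on_compose2[OF fu_cont]) auto
  then obtain d where "d > 0" "\<And>x v. v \<in> {s} \<Longrightarrow> d \<le> deficit x v"
    using periodic_lower_bound[of "2 * R" "{s}" deficit] R assms deficit_pos deficit_periodic by auto
  then show ?thesis
    using that[of d] deficit_mono[OF assms] order_trans by fastforce
qed

text \<open>The strict decrease of the rate between \<open>v\<close> and \<open>\<tau> * v\<close>
  is made uniform by compactness of one period times \<open>{s..B}\<close>.\<close>

lemma rate_gap:
  assumes "0 < s" "1 < \<tau>"
  obtains d where "d > 0" "\<And>x v. s \<le> v \<Longrightarrow> v \<le> B \<Longrightarrow> d \<le> f x v / v - f x (\<tau> * v) / (\<tau> * v)"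
proof -
  have "continuous_on (UNIV \<times> {s..B}) (\<lambda>(x, v). f x v / v - f x (\<tau> * v) / (\<tau> * v))"
    using assms unfolding case_prod_unfold
    by (intro continuous_on_diff rate_continuous continuous_intros) auto
  moreover have "periodic (2 * R) (\<lambda>x. f x v / v - f x (\<tau> * v) / (\<tau> * v))" if "v \<in> {s..B}" for v
    using f_periodic[of v] f_periodic[of "\<tau> * v"] that assms by (simp add: periodic_def)
  moreover have "f x v / v - f x (\<tau> * v) / (\<tau> * v) > 0" if "v \<in> {s..B}" for x v
    using f_decreasing[of v "\<tau> * v" x] that assms by simp
  ultimately obtain d where "d > 0"
    "\<And>x v. v \<in> {s..B} \<Longrightarrow> d \<le> f x v / v - f x (\<tau> * v) / (\<tau> * v)"
    using R by (rule_tac periodic_lower_bound[of "2 * R" "{s..B}"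
        "\<lambda>x v. f x v / v - f x (\<tau> * v) / (\<tau> * v)"]) auto
  then show ?thesis using that by simp
qed

end

section \<open>Spreading of mass\<close>

context spreading_kernel
begin

text \<open>The exceptional null set of \<open>local_lower_bound\<close> depends on the centre, so
  it is applied only at the countably many centres \<open>i * r\<close>. The window at
  \<open>x\<close> is then compared with that at a nearby lattice point by
  \<open>window_step\<close>, which has no exceptional set.\<close>

lemma AE_ge_window:
  assumes u: "profile B u" and C: "C > 0" and super: "AE x in lborel. convolution J u x \<le> C * u x"
  obtains k where "k > 0" "AE x in lborel. k * window u x \<le> u x"
proof -
  define \<kappa> where "\<kappa> = 2 * r\<^sup>2 * j\<^sup>2 / C\<^sup>2"
  define k where "k = r * j\<^sup>2 / C\<^sup>2"
  have pos: "\<kappa> > 0" "k > 0" using r j C by (simp_all add: \<kappa>_def k_def)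
  have "AE x in lborel. \<forall>i::int. \<bar>x - of_int i * r\<bar> \<le> 2 * r \<longrightarrow> k * window u (of_int i * r) \<le> u x"
    unfolding AE_all_countable k_def using local_lower_bound[OF u C super] by blast
  then have "AE x in lborel. k * \<kappa> * window u x \<le> u x"
  proof eventually_elim
    case (elim x)
    obtain y i where "y \<in> {0..r}" "x = y + of_int i * r" using period_representative[OF r] .
    then have near: "\<bar>x - of_int i * r\<bar> \<le> r" by auto
    have "\<kappa> * window u x \<le> window u (of_int i * r)"
      unfolding \<kappa>_def by (rule window_step[OF u C super]) (use near in linarith)
    then have "k * (\<kappa> * window u x) \<le> k * window u (of_int i * r)"
      using pos by (intro mult_left_mono) auto
    also have "\<dots> \<le> u x" using elim near r by auto
    finally show ?case by (simp add: mult.assoc)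
  qed
  with pos show ?thesis by (intro that[of "k * \<kappa>"]) auto
qed

text \<open>The windows centred at the multiples of \<open>r\<close> cover the line; if all had
  integral zero, \<open>u\<close> would vanish off a countable union of null sets.\<close>

lemma window_pos:
  assumes u: "profile B u" and nz: "\<not> (AE x in lborel. u x = 0)"
  obtains x0 where "window u x0 > 0"
proof (rule ccontr)
  assume *: "\<not> thesis"
  have "window u x = 0" for x
    using that[of x] * integral_interval_nonneg[OF u] by (meson antisym not_le)
  then have "AE y in lborel. indicator {x - r..x + r} y * u y = 0" for x
    using profileD[OF u] by (subst integral_nonneg_eq_0_iff_AE[symmetric])
      (auto intro!: integrable_interval_profile[OF u])
  then have "AE y in lborel. \<forall>i::int. indicator {of_int i * r - r..of_int i * r + r} y * u y = 0"
    unfolding AE_all_countable by blast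
  then have "AE y in lborel. u y = 0"
  proof eventually_elim
    case (elim y)
    obtain t i where "t \<in> {0..r}" "y = t + of_int i * r" using period_representative[OF r] .
    then show ?case using elim[rule_format, of i] r by (auto simp: indicator_def)
  qed
  with nz show False ..
qed

text \<open>The long interval is covered by the windows centred at \<open>z + i * r\<close> with |i|
  at most \<open>N\<close>, and a chain of at most \<open>N\<close> steps carries the mass of each
  to the window at \<open>z\<close>. The constant does not depend on \<open>z\<close>.\<close>

lemma integral_le_window:
  assumes u: "profile B u" and C: "C > 0" and super: "AE x in lborel. convolution J u x \<le> C * u x"
  obtains k where "k > 0" "\<And>z. k * (LINT x|lborel. indicator {z - n..z + n} x * u x) \<le> window u z"
proof -
  define \<kappa> where "\<kappa> = 2 * r\<^sup>2 * j\<^sup>2 / C\<^sup>2"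
  have \<kappa>: "\<kappa> > 0" using r j C by (simp add: \<kappa>_def)
  \<comment> \<open>The extra 1 absorbs the distance, at most \<open>r\<close>, from a point to the
    lattice point below it.\<close>
  obtain N :: nat where N: "n / r + 1 \<le> real N" using real_arch_simple by blast
  let ?I = "{- int N..int N}"
  have bound: "\<kappa> ^ N * (LINT x|lborel. indicator {z - n..z + n} x * u x) \<le> real (card ?I) * window u z" for z
  proof -
    have "(LINT x|lborel. indicator {z - n..z + n} x * u x)
       \<le> (LINT x|lborel. (\<Sum>i\<in>?I. indicator {z + of_int i * r - r..z + of_int i * r + r} x * u x))"
    proof (rule integral_mono)
      fix x
      show "indicator {z - n..z + n} x * u x
         \<le> (\<Sum>i\<in>?I. indicator {z + of_int i * r - r..z + of_int i * r + r} x * u x)"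
      proof (cases "x \<in> {z - n..z + n}")
        case True
        obtain t i where ti: "t \<in> {0..r}" "x - z = t + of_int i * r" using period_representative[OF r] .
        have "\<bar>of_int i * r\<bar> \<le> n + r" using True ti by auto
        also have "\<dots> \<le> real N * r" using N r by (simp add: field_simps)
        finally have "\<bar>of_int i\<bar> \<le> real N" using r by (simp add: abs_mult)
        then have i: "i \<in> ?I" by auto
        have "u x = indicator {z + of_int i * r - r..z + of_int i * r + r} x * u x"
          using ti r by (auto simp: indicator_def)
        also have "\<dots> \<le> (\<Sum>i\<in>?I. indicator {z + of_int i * r - r..z + of_int i * r + r} x * u x)"
          using i profileD[OF u] by (intro member_le_sum) auto
        finally show ?thesis using True by simp
      next
        case False
        then show ?thesis using profileD[OF u] by (auto intro!: sum_nonneg)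
      qed
    qed (intro integrable_interval_profile[OF u] Bochner_Integration.integrable_sum)+
    also have "\<dots> = (\<Sum>i\<in>?I. window u (z + of_int i * r))"
      by (intro Bochner_Integration.integral_sum integrable_interval_profile[OF u])
    finally have "\<kappa> ^ N * (LINT x|lborel. indicator {z - n..z + n} x * u x)
        \<le> (\<Sum>i\<in>?I. \<kappa> ^ N * window u (z + of_int i * r))"
      using \<kappa> by (simp add: sum_distrib_left[symmetric])
    also have "\<dots> \<le> (\<Sum>i\<in>?I. window u z)"
    proof (rule sum_mono)
      fix i assume "i \<in> ?I"
      then have "\<bar>of_int i\<bar> * r \<le> real N * r" using r by (intro mult_right_mono) auto
      then show "\<kappa> ^ N * window u (z + of_int i * r) \<le> window u z"
        unfolding \<kappa>_def using r by (intro window_chain[OF u C super]) (auto simp: abs_mult)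
    qed
    finally show ?thesis by simp
  qed
  show ?thesis
  proof
    show "\<kappa> ^ N / real (card ?I) > 0" using \<kappa> by simp
    show "\<kappa> ^ N / real (card ?I) * (LINT x|lborel. indicator {z - n..z + n} x * u x) \<le> window u z" for z
      using bound[of z] by (simp add: field_simps)
  qed
qed

end

section \<open>Comparison of solutions\<close>

text \<open>\<open>S\<close> is the essential supremum of \<open>u / v\<close>, obtained as the
  least multiplier \<open>t\<close> with u \<le> t v almost everywhere. It is finite because
  \<open>v\<close> is bounded away from 0, and no smaller multiplier works.\<close>

lemma ess_ratio:
  fixes u v :: "real \<Rightarrow> real"
  assumes u: "profile B u" and v: "s > 0" "AE x in lborel. s \<le> v x"
    and nle: "\<not> (AE x in lborel. u x \<le> \<tau> * v x)" and \<tau>: "\<tau> \<ge> 0"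
  obtains S where "S > \<tau>" "AE x in lborel. u x \<le> S * v x"
    "\<And>\<theta>. 0 \<le> \<theta> \<Longrightarrow> \<theta> < 1 \<Longrightarrow> \<not> (AE x in lborel. u x \<le> \<theta> * S * v x)"
proof -
  define T where "T = {t. 0 \<le> t \<and> (AE x in lborel. u x \<le> t * v x)}"
  define S where "S = Inf T"
  have bdd: "bdd_below T" by (rule bdd_belowI[of _ 0]) (simp add: T_def)
  have "AE x in lborel. u x \<le> B / s * v x"
    using v(2)
  proof eventually_elim
    case (elim x)
    have "u x \<le> B / s * s" using profileD(3)[OF u, of x] v(1) by simp
    also have "\<dots> \<le> B / s * v x" using elim profileD(4)[OF u] v(1) by (intro mult_left_mono) auto
    finally show ?case .
  qed
  then have ne: "B / s \<in> T" using profileD(4)[OF u] v(1) by (simp add: T_def)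
  have up: "AE x in lborel. u x \<le> t * v x" if St: "S < t" for t
  proof -
    obtain t' where t': "t' \<in> T" "t' < t"
      using cInf_lessD[of T t, folded S_def, OF _ St] ne by auto
    then have "AE x in lborel. u x \<le> t' * v x" by (simp add: T_def)
    then show ?thesis using v(2)
    proof eventually_elim
      case (elim x)
      have "t' * v x \<le> t * v x" using elim(2) t'(2) v(1) by (intro mult_right_mono) linarith+
      then show ?case using elim(1) by linarith
    qed
  qed
  \<comment> \<open>A sequence of multipliers decreasing to \<open>S\<close> suffices, so only
    countably many null sets are collected and the infimum itself is admissible.\<close>
  have "AE x in lborel. \<forall>n. u x \<le> (S + 1 / real (Suc n)) * v x"
    unfolding AE_all_countable by (intro allI up) simp
  then have AE_S: "AE x in lborel. u x \<le> S * v x"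
  proof eventually_elim
    case (elim x)
    have "(\<lambda>n. (S + 1 / real (Suc n)) * v x) \<longlonglongrightarrow> (S + 0) * v x"
      by (rule tendsto_mult_right[OF tendsto_add[OF tendsto_const LIMSEQ_Suc[OF lim_1_over_n]]])
    then have "u x \<le> (S + 0) * v x" by (rule LIMSEQ_le_const) (use elim in simp)
    then show ?case by simp
  qed
  have S0: "S \<ge> 0" unfolding S_def
    by (rule cInf_greatest) (use ne in blast, simp add: T_def)
  have S\<tau>: "S > \<tau>"
  proof (rule ccontr)
    assume "\<not> S > \<tau>"
    from AE_S v(2) have "AE x in lborel. u x \<le> \<tau> * v x"
    proof eventually_elim
      case (elim x)
      have "S * v x \<le> \<tau> * v x"
        using elim(2) \<open>\<not> S > \<tau>\<close> v(1) by (intro mult_right_mono) linarith+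
      then show ?case using elim(1) by linarith
    qed
    with nle show False ..
  qed
  show ?thesis
  proof (rule that[OF S\<tau> AE_S])
    fix \<theta> :: real assume \<theta>: "0 \<le> \<theta>" "\<theta> < 1"
    show "\<not> (AE x in lborel. u x \<le> \<theta> * S * v x)"
    proof
      assume "AE x in lborel. u x \<le> \<theta> * S * v x"
      then have "\<theta> * S \<in> T" using \<theta> S0 by (simp add: T_def)
      then have "S \<le> \<theta> * S" using cInf_lower[OF _ bdd] by (simp only: S_def)
      moreover have "\<theta> * S < 1 * S" using \<theta> S\<tau> \<tau> by (intro mult_strict_right_mono) linarith+
      ultimately show False by simp
    qed
  qed
qed

section \<open>Solutions and their comparison through ratios\<close>

locale kpp_dispersal = kpp_reaction R f fu + dispersal_kernel J
  for R and f fu :: "real \<Rightarrow> real \<Rightarrow> real" and J +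
  assumes J_pos: "\<exists>b. J b > 0"
begin

definition solution :: "real \<Rightarrow> (real \<Rightarrow> real) \<Rightarrow> bool" where
  "solution B u \<longleftrightarrow> B > 0 \<and> profile B u \<and> (AE x in lborel. convolution J u x = u x - f x (u x))"

lemma solutionD:
  assumes "solution B u"
  shows "B > 0" "profile B u" "AE x in lborel. convolution J u x = u x - f x (u x)"
  using assms by (simp_all add: solution_def)

text \<open>The rate \<open>f x v / v\<close> is bounded below on densities up to \<open>B\<close>,
  so J*u = u - f(x,u) is at most a multiple of \<open>u\<close>. This is the supersolution property
  that the spreading lemmas require.\<close>

lemma solution_super:
  assumes "solution B u"
  obtains C where "C > 0" "AE x in lborel. convolution J u x \<le> C * u x"
proof -
  note u = solutionD[OF assms]
  obtain D where D: "D > 0" "\<And>x v. 0 < v \<Longrightarrow> v \<le> B \<Longrightarrow> deficit x v \<le> D"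
    using deficit_bounded[OF u(1)] by blast
  obtain A where A: "A > 0" "\<And>x. \<bar>fu x 0\<bar> \<le> A"
    by (rule periodic_upper_bound[OF _ fu_cont fu_periodic]) (use R in auto)
  have "AE x in lborel. convolution J u x \<le> (1 + A + D) * u x"
    using u(3)
  proof eventually_elim
    case (elim x)
    show ?case
    proof (cases "u x = 0")
      case True
      then show ?thesis using elim f_zero by simp
    next
      case False
      then have ux: "0 < u x" "u x \<le> B"
        using profileD(2,3)[OF u(2), of x] by auto
      have "1 - f x (u x) / u x \<le> 1 + A + D"
        using D(2)[OF ux, of x] A(2)[of x] by (simp add: deficit_def)
      then have "u x * (1 - f x (u x) / u x) \<le> u x * (1 + A + D)"
        using ux by (intro mult_left_mono) auto
      then have "u x - f x (u x) \<le> (1 + A + D) * u x"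
        using ux by (simp add: right_diff_distrib mult.commute)
      then show ?thesis using elim by simp
    qed
  qed
  then show ?thesis using A(1) D(1) by (intro that[of "1 + A + D"]) auto
qed

text \<open>Suppose the essential supremum \<open>S\<close> of \<open>u / v\<close> exceeded 1.
  Where \<open>u / v\<close> is almost \<open>S\<close>, J*u \<le> S J*v and the two equations force
  the rates at \<open>u\<close> and \<open>v\<close> to be closer than \<open>d\<close>, while u >
  \<tau> v with \<tau> > 1 separates them by at least \<open>d\<close>.\<close>

lemma solution_le:
  assumes su: "solution B u" and sv: "solution B' v" and s: "s > 0" "AE x in lborel. s \<le> v x"
  shows "AE x in lborel. u x \<le> v x"
proof (rule ccontr)
  note u = solutionD[OF su] and v = solutionD[OF sv]
  assume "\<not> ?thesis"
  then have "\<not> (AE x in lborel. u x \<le> 1 * v x)" by simp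
  then obtain S where S: "S > 1" "AE x in lborel. u x \<le> S * v x"
    "\<And>\<theta>. 0 \<le> \<theta> \<Longrightarrow> \<theta> < 1 \<Longrightarrow> \<not> (AE x in lborel. u x \<le> \<theta> * S * v x)"
    by (rule ess_ratio[OF u(2) s, of 1]) simp_all
  \<comment> \<open>Strictly between 1 and \<open>S\<close>, so that the gap \<open>d\<close> is
    fixed before the tolerance \<open>e\<close>, and points with ratio close to \<open>S\<close>
    still have ratio above \<tau>.\<close>
  define \<tau> where "\<tau> = (1 + S) / 2"
  have \<tau>: "1 < \<tau>" "\<tau> < S" using S(1) by (auto simp: \<tau>_def)
  obtain d where d: "d > 0"
    "\<And>x w. s \<le> w \<Longrightarrow> w \<le> B' \<Longrightarrow> d \<le> f x w / w - f x (\<tau> * w) / (\<tau> * w)"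
    using rate_gap[OF s(1) \<tau>(1)] by blast
  \<comment> \<open>The first entry makes a ratio above \<open>S / (1 + e)\<close> exceed \<tau>;
    the second keeps the error \<open>e\<close> (J*v)/v, at most \<open>e * (B' / s)\<close>, below
    \<open>d\<close>.\<close>
  define e where "e = min (S / \<tau> - 1) (d * s / (2 * B'))"
  have e: "e > 0" "(1 + e) * \<tau> \<le> S" "e * (B' / s) < d"
  proof -
    show "e > 0" using \<tau> d s v(1) by (auto simp: e_def)
    have "e \<le> S / \<tau> - 1" "e \<le> d * s / (2 * B')" by (auto simp: e_def)
    then show "(1 + e) * \<tau> \<le> S" using \<tau> by (simp add: field_simps)
    have "e * (B' / s) \<le> d * s / (2 * B') * (B' / s)"
      using v(1) s(1) by (intro mult_right_mono) (auto simp: e_def)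
    also have "\<dots> = d / 2" using v(1) s(1) by simp
    finally show "e * (B' / s) < d" using d(1) by linarith
  qed
  have cuv: "convolution J u x \<le> S * convolution J v x" for x
  proof -
    have "profile (S * B') (\<lambda>x. S * v x)"
      using profileD[OF v(2)] S(1) by (auto simp: profile_def)
    from convolution_mono[OF u(2) this S(2), of x] show ?thesis
      by (simp add: convolution_cmult[OF v(2)])
  qed
  have "AE x in lborel. u x \<le> 1 / (1 + e) * S * v x"
    using u(3) v(3) s(2)
  proof eventually_elim
    case (elim x)
    show ?case
    proof (rule ccontr)
      assume "\<not> ?case"
      then have ux: "S * v x < (1 + e) * u x" using e by (simp add: field_simps)
      have vx: "v x > 0" "v x \<le> B'" using elim s profileD[OF v(2)] by auto
      have "(1 + e) * (\<tau> * v x) \<le> S * v x" using e vx by (simp add: mult.assoc[symmetric])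
      then have "(1 + e) * (\<tau> * v x) < (1 + e) * u x" using ux by linarith
      then have \<tau>u: "\<tau> * v x < u x" using e(1) by simp
      have \<tau>v: "\<tau> * v x > 0" using \<tau> vx by simp
      have upos: "u x > 0" using \<tau>u \<tau>v by linarith
      have cv0: "convolution J v x \<ge> 0" by (rule convolution_nonneg[OF v(2)])
      have "1 - f x (u x) / u x = convolution J u x / u x"
        using elim(1) upos by (simp add: field_simps)
      also have "\<dots> \<le> S * convolution J v x / u x"
        using cuv upos by (intro divide_right_mono) auto
      also have "\<dots> \<le> (1 + e) * (convolution J v x / v x)"
        using mult_right_mono[OF less_imp_le[OF ux] cv0] upos vx by (simp add: field_simps)
      also have "\<dots> = convolution J v x / v x + e * (convolution J v x / v x)"
        by (simp only: distrib_right mult_1)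
      also have "\<dots> \<le> convolution J v x / v x + e * (B' / s)"
        using cv0 convolution_le[OF v(2)] elim(3) s(1) e(1) v(1)
        by (intro add_left_mono mult_left_mono frac_le) auto
      also have "convolution J v x / v x = 1 - f x (v x) / v x"
        using elim(2) vx by (simp add: field_simps)
      finally have "f x (v x) / v x - f x (u x) / u x < d" using e(3) by linarith
      moreover have "f x (u x) / u x < f x (\<tau> * v x) / (\<tau> * v x)"
        by (rule f_decreasing[OF \<tau>v \<tau>u])
      moreover have "d \<le> f x (v x) / v x - f x (\<tau> * v x) / (\<tau> * v x)"
        using d(2)[OF elim(3) vx(2)] .
      ultimately show False by linarith
    qed
  qed
  with S(3)[of "1 / (1 + e)"] e(1) show False by (auto simp: field_simps)
qed

end

section \<open>The lower bound\<close>

locale kpp_eigenpair = kpp_dispersal R f fu J for R f fu J +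
  fixes lam \<phi>0 \<Phi> :: real and \<phi> :: "real \<Rightarrow> real"
  assumes \<phi>: "profile \<Phi> \<phi>" and \<phi>_periodic: "periodic (2 * R) \<phi>"
    and \<phi>0: "\<phi>0 > 0" and \<phi>_ge: "\<phi>0 \<le> \<phi> x"
    and eigen: "convolution J \<phi> x = (1 - fu x 0 - lam) * \<phi> x"
begin

lemma \<phi>_pos: "\<phi> x > 0"
  using \<phi>0 \<phi>_ge[of x] by linarith

lemma \<Phi>_pos: "\<Phi> > 0"
  using \<phi>_pos[of 0] profileD(3)[OF \<phi>, of 0] by linarith

text \<open>The same comparison against multiples of the eigenfunction. Where u/\<phi> is nearly
  maximal, (J*u)/u hardly exceeds (J*\<phi>)/\<phi> = 1 - \<open>fu x 0\<close> -
  \<open>lam\<close>, so for \<open>lam \<ge> 0\<close> the deficit at \<open>u\<close> is below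
  \<open>d\<close>; but \<open>u\<close> is bounded away from 0 there.\<close>

lemma solution_zero:
  assumes su: "solution B u" and lam: "lam \<ge> 0"
  shows "AE x in lborel. u x = 0"
proof -
  note u = solutionD[OF su]
  have "AE x in lborel. u x \<le> 0 * \<phi> x"
  proof (rule ccontr)
    assume "\<not> ?thesis"
    then obtain S where S: "S > 0" "AE x in lborel. u x \<le> S * \<phi> x"
      "\<And>\<theta>. 0 \<le> \<theta> \<Longrightarrow> \<theta> < 1 \<Longrightarrow> \<not> (AE x in lborel. u x \<le> \<theta> * S * \<phi> x)"
      using \<phi>_ge by (rule_tac ess_ratio[OF u(2) \<phi>0, of \<phi> 0]) simp_all
    obtain d where d: "d > 0" "\<And>x w. S * \<phi>0 / 2 \<le> w \<Longrightarrow> d \<le> deficit x w"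
      using deficit_lower_bound[of "S * \<phi>0 / 2"] S(1) \<phi>0 by auto
    \<comment> \<open>The entry 1 ensures \<open>u x \<ge> S * \<phi>0 / 2\<close> at the points
      considered, where \<open>d\<close> bounds the deficit from below; the other keeps the error
      \<open>e * (\<Phi> / \<phi>0)\<close> below \<open>d\<close>.\<close>
    define e where "e = min 1 (d * \<phi>0 / (2 * \<Phi>))"
    have e: "e > 0" "e \<le> 1" "e * (\<Phi> / \<phi>0) < d"
    proof -
      show "e > 0" "e \<le> 1" using \<phi>0 \<Phi>_pos d by (auto simp: e_def)
      have "e * (\<Phi> / \<phi>0) \<le> d * \<phi>0 / (2 * \<Phi>) * (\<Phi> / \<phi>0)"
        using \<Phi>_pos \<phi>0 by (intro mult_right_mono) (auto simp: e_def)
      also have "\<dots> = d / 2" using \<Phi>_pos \<phi>0 by simp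
      finally show "e * (\<Phi> / \<phi>0) < d" using d(1) by linarith
    qed
    have cu: "convolution J u x \<le> S * convolution J \<phi> x" for x
    proof -
      have "profile (S * \<Phi>) (\<lambda>x. S * \<phi> x)"
        using profileD[OF \<phi>] S(1) by (auto simp: profile_def)
      from convolution_mono[OF u(2) this S(2), of x] show ?thesis
        by (simp add: convolution_cmult[OF \<phi>])
    qed
    have "AE x in lborel. u x \<le> 1 / (1 + e) * S * \<phi> x"
      using u(3)
    proof eventually_elim
      case (elim x)
      show ?case
      proof (rule ccontr)
        assume "\<not> ?case"
        then have ux: "S * \<phi> x < (1 + e) * u x" using e by (simp add: field_simps)
        have S\<phi>: "S * \<phi> x > 0" "S * \<phi>0 \<le> S * \<phi> x" using S(1) \<phi>_pos \<phi>_ge by auto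
        have upos: "u x > 0"
          using S\<phi>(1) ux e(1) by (smt (verit) mult_nonneg_nonpos)
        have "(1 + e) * u x \<le> 2 * u x" using e upos by (intro mult_right_mono) auto
        then have u_ge: "S * \<phi>0 / 2 \<le> u x" using ux S\<phi> by linarith
        have c0: "convolution J \<phi> x \<ge> 0" by (rule convolution_nonneg[OF \<phi>])
        have "1 - f x (u x) / u x = convolution J u x / u x"
          using elim upos by (simp add: field_simps)
        also have "\<dots> \<le> S * convolution J \<phi> x / u x"
          using cu upos by (intro divide_right_mono) auto
        also have "\<dots> \<le> (1 + e) * (convolution J \<phi> x / \<phi> x)"
          using mult_right_mono[OF less_imp_le[OF ux] c0] upos \<phi>_pos[of x] by (simp add: field_simps)
        also have "\<dots> = convolution J \<phi> x / \<phi> x + e * (convolution J \<phi> x / \<phi> x)"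
          by (simp only: distrib_right mult_1)
        also have "\<dots> \<le> convolution J \<phi> x / \<phi> x + e * (\<Phi> / \<phi>0)"
          using c0 convolution_le[OF \<phi>] \<phi>_ge \<phi>0 e(1) \<Phi>_pos
          by (intro add_left_mono mult_left_mono frac_le) auto
        also have "convolution J \<phi> x / \<phi> x = 1 - fu x 0 - lam"
          using eigen[of x] \<phi>_pos[of x] by (simp add: field_simps)
        finally have "deficit x (u x) < d" using e(3) lam by (simp add: deficit_def)
        with d(2)[OF u_ge, of x] show False by linarith
      qed
    qed
    with S(3)[of "1 / (1 + e)"] e(1) show False by (auto simp: field_simps)
  qed
  then show ?thesis
    by eventually_elim (use profileD(2)[OF u(2)] in \<open>auto intro: antisym\<close>)
qed

text \<open>For a solution, the integrand in \<open>picone\<close> is \<phi> squared times (deficit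
  + \<open>lam\<close>). The affine bound on the deficit and the sign of \<open>lam\<close> bound it
  above, and \<open>flux_le\<close> bounds its integral below. The local bound \<open>c\<close> does
  not enter the resulting estimate.\<close>

lemma integral_lower_bound:
  assumes su: "solution B u" and lam: "lam < 0" and \<eta>: "\<eta> > 0" and D: "D > 0"
    and def: "\<And>x v. 0 < v \<Longrightarrow> v \<le> B \<Longrightarrow> deficit x v \<le> \<eta> + D * v"
    and L: "0 \<le> L" "L \<le> n"
    and c: "0 < c" "AE x in lborel. x \<in> {z - n..z + n} \<longrightarrow> c \<le> u x"
  shows "2 * n * (- lam * \<phi>0\<^sup>2 - \<Phi>\<^sup>2 * \<eta> - \<Phi>\<^sup>2 * tail L) - 2 * L * \<Phi>\<^sup>2
    \<le> \<Phi>\<^sup>2 * D * (LINT x|lborel. indicator {z - n..z + n} x * u x)"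
proof -
  note u = solutionD[OF su]
  let ?A = "{z - n..z + n}"
  have n: "n \<ge> 0" using L by simp
  \<comment> \<open>\<open>picone\<close> divides by \<open>u\<close> at every point of
    \<open>?A\<close>, but the bound by \<open>c\<close> holds only almost everywhere;
    \<open>w\<close> repairs \<open>u\<close> on a null set without changing its
    convolution.\<close>
  define w where "w x = (if x \<in> ?A then max c (u x) else u x)" for x
  have w: "profile (max c B) w"
    using profileD[OF u(2)] c(1) unfolding profile_def w_def by (auto simp: max_def intro: order_trans)
  note [measurable] = profileD(1)[OF u(2)] profileD(1)[OF w] profileD(1)[OF \<phi>]
    convolution_measurable[OF w] convolution_measurable[OF \<phi>]
  have wu: "AE x in lborel. w x = u x"
    using c(2) by eventually_elim (auto simp: w_def)
  have cw: "convolution J w x = convolution J u x" for x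
    by (rule convolution_cong_AE[OF w u(2) wu])
  let ?P = "\<lambda>x. indicator ?A x * ((\<phi> x)\<^sup>2 * (convolution J w x / w x) - \<phi> x * convolution J \<phi> x)"
  let ?Q = "\<lambda>x. (\<Phi>\<^sup>2 * \<eta> + lam * \<phi>0\<^sup>2) * indicator ?A x + \<Phi>\<^sup>2 * D * (indicator ?A x * u x)"
  have intQ: "Bochner_Integration.integrable lborel ?Q"
    by (intro Bochner_Integration.integrable_add integrable_mult_right integrable_real_indicator
        integrable_interval_profile[OF u(2)]) (auto simp: emeasure_lborel_Icc_eq)
  have "- (\<Phi>\<^sup>2 * (2 * n * tail L + 2 * L)) \<le> (LINT x|lborel. ?P x)"
    using mult_left_mono[OF flux_le[OF L, of z], of "\<Phi>\<^sup>2"]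
    by (intro order_trans[OF _ picone[OF w \<phi> c(1)]]) (auto simp: w_def)
  also have "\<dots> \<le> (LINT x|lborel. ?Q x)"
  proof (rule integral_mono_AE)
    show "Bochner_Integration.integrable lborel ?P"
    proof (rule integrable_indicator_times_bounded)
      fix x assume "x \<in> ?A"
      then have "w x \<ge> c" by (simp add: w_def)
      have "\<bar>(\<phi> x)\<^sup>2 * (convolution J w x / w x)\<bar> \<le> \<Phi>\<^sup>2 * (max c B / c)"
        using profileD[OF \<phi>] profileD[OF w] c(1) \<open>w x \<ge> c\<close> convolution_nonneg[OF w] convolution_le[OF w]
        by (auto simp: abs_mult intro!: mult_mono power_mono frac_le)
      moreover have "\<bar>\<phi> x * convolution J \<phi> x\<bar> \<le> \<Phi> * \<Phi>"
        using profileD[OF \<phi>] convolution_nonneg[OF \<phi>] convolution_le[OF \<phi>]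
        by (auto simp: abs_mult intro!: mult_mono)
      ultimately show "\<bar>(\<phi> x)\<^sup>2 * (convolution J w x / w x) - \<phi> x * convolution J \<phi> x\<bar>
          \<le> \<Phi>\<^sup>2 * (max c B / c) + \<Phi> * \<Phi>" by linarith
    qed (auto simp: emeasure_lborel_Icc_eq)
    show "AE x in lborel. ?P x \<le> ?Q x"
      using u(3) wu c(2)
    proof eventually_elim
      case (elim x)
      show ?case
      proof (cases "x \<in> ?A")
        case True
        then have ux: "u x > 0" "u x \<le> B" using elim(3) c(1) profileD[OF u(2)] by auto
        have quotient: "convolution J u x / u x = 1 - f x (u x) / u x"
          using elim(1) ux(1) by (simp add: field_simps)
        have "(\<phi> x)\<^sup>2 * (convolution J w x / w x) - \<phi> x * convolution J \<phi> x
            = (\<phi> x)\<^sup>2 * deficit x (u x) + lam * (\<phi> x)\<^sup>2"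
          unfolding cw eigen deficit_def elim(2) quotient by (simp add: algebra_simps power2_eq_square)
        also have "\<dots> \<le> \<Phi>\<^sup>2 * (\<eta> + D * u x) + lam * \<phi>0\<^sup>2"
        proof (rule add_mono)
          show "(\<phi> x)\<^sup>2 * deficit x (u x) \<le> \<Phi>\<^sup>2 * (\<eta> + D * u x)"
            using profileD[OF \<phi>] def[OF ux] deficit_pos[OF ux(1)]
            by (intro mult_mono power_mono) (auto simp: less_imp_le)
          show "lam * (\<phi> x)\<^sup>2 \<le> lam * \<phi>0\<^sup>2"
            using lam \<phi>0 \<phi>_ge by (intro mult_left_mono_neg power_mono) auto
        qed
        finally show ?thesis using True by (simp add: algebra_simps)
      qed simp
    qed
  qed (rule intQ)
  also have "\<dots> = (\<Phi>\<^sup>2 * \<eta> + lam * \<phi>0\<^sup>2) * (2 * n) + \<Phi>\<^sup>2 * D * (LINT x|lborel. indicator ?A x * u x)"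
    using n integrable_interval_profile[OF u(2)]
    by (subst Bochner_Integration.integral_add)
       (auto simp: emeasure_lborel_Icc_eq intro!: integrable_mult_right)
  finally show ?thesis by (simp add: algebra_simps)
qed

text \<open>Two stages: spreading first gives a positive bound on each bounded interval, then the
  integral estimate gives mass independent of position, which spreading converts into a global
  bound.\<close>

lemma solution_lower_bound:
  assumes su: "solution B u" and lam: "lam < 0" and nz: "\<not> (AE x in lborel. u x = 0)"
  obtains c where "c > 0" "AE x in lborel. c \<le> u x"
proof -
  note u = solutionD[OF su]
  obtain C where C: "C > 0" "AE x in lborel. convolution J u x \<le> C * u x"
    using solution_super[OF su] .
  obtain b where "J b > 0" using J_pos by blast
  then obtain r j where "spreading_kernel J b r j" using spreading by blast
  then interpret spreading_kernel J b r j .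
  obtain k where k: "k > 0" "AE x in lborel. k * window u x \<le> u x"
    using AE_ge_window[OF u(2) C] .
  obtain x0 where x0: "window u x0 > 0" using window_pos[OF u(2) nz] .
  define \<kappa> where "\<kappa> = 2 * r\<^sup>2 * j\<^sup>2 / C\<^sup>2"
  have \<kappa>: "\<kappa> > 0" using r j C by (simp add: \<kappa>_def)
  \<comment> \<open>This bound may degenerate as \<open>z\<close> moves away; it only makes the
    quotient in \<open>picone\<close> admissible.\<close>
  have local: "\<exists>c>0. AE x in lborel. x \<in> {z - n..z + n} \<longrightarrow> c \<le> u x" for z n
  proof -
    obtain N :: nat where N: "(\<bar>n\<bar> + \<bar>z - x0\<bar>) / r \<le> real N" using real_arch_simple by blast
    have "AE x in lborel. x \<in> {z - n..z + n} \<longrightarrow> k * (\<kappa> ^ N * window u x0) \<le> u x"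
      using k(2)
    proof eventually_elim
      case (elim x)
      show ?case
      proof
        assume "x \<in> {z - n..z + n}"
        then have "\<bar>x - x0\<bar> \<le> real N * r" using N r by (auto simp: field_simps)
        then have "k * (\<kappa> ^ N * window u x0) \<le> k * window u x"
          unfolding \<kappa>_def using k by (intro mult_left_mono window_chain[OF u(2) C]) auto
        then show "k * (\<kappa> ^ N * window u x0) \<le> u x" using elim by simp
      qed
    qed
    then show ?thesis using k \<kappa> x0 by (intro exI[of _ "k * (\<kappa> ^ N * window u x0)"]) auto
  qed
  \<comment> \<open>A quarter of the gain |lam| \<phi>0 squared is spent on the deficit at small
    densities and a quarter on the tail, leaving half.\<close>
  define \<eta> where "\<eta> = - lam * \<phi>0\<^sup>2 / (4 * \<Phi>\<^sup>2)"
  have \<eta>: "\<eta> > 0" using lam \<phi>0 \<Phi>_pos by (auto simp: \<eta>_def divide_neg_pos mult_neg_pos)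
  have \<Phi>\<eta>: "\<Phi>\<^sup>2 * \<eta> = - lam * \<phi>0\<^sup>2 / 4" using \<Phi>_pos by (simp add: \<eta>_def)
  obtain D where D: "D > 0" "\<And>x v. 0 < v \<Longrightarrow> v \<le> B \<Longrightarrow> deficit x v \<le> \<eta> + D * v"
    using deficit_affine_bound[OF \<eta> u(1)] by blast
  obtain L :: nat where L: "tail (real L) < \<eta>"
    using order_tendstoD(2)[OF tail_tendsto_0 \<eta>] by (auto simp: eventually_sequentially)
  define \<mu> where "\<mu> = - lam * \<phi>0\<^sup>2"
  have \<mu>: "\<mu> > 0" using lam \<phi>0 by (simp add: \<mu>_def mult_neg_pos)
  \<comment> \<open>Long enough for the remaining gain \<open>n * \<mu>\<close> to exceed the
    boundary layer term by 1.\<close>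
  define n where "n = max (real L) ((2 * real L * \<Phi>\<^sup>2 + 1) / \<mu>)"
  have n: "real L \<le> n" "2 * real L * \<Phi>\<^sup>2 + 1 \<le> n * \<mu>"
    using \<mu> by (auto simp: n_def pos_divide_le_eq[symmetric])
  have mass: "1 / (\<Phi>\<^sup>2 * D) \<le> (LINT x|lborel. indicator {z - n..z + n} x * u x)" for z
  proof -
    obtain c where c: "c > 0" "AE x in lborel. x \<in> {z - n..z + n} \<longrightarrow> c \<le> u x"
      using local by blast
    have "\<Phi>\<^sup>2 * tail (real L) \<le> \<Phi>\<^sup>2 * \<eta>" using L by (intro mult_left_mono) auto
    then have "\<mu> / 2 \<le> - lam * \<phi>0\<^sup>2 - \<Phi>\<^sup>2 * \<eta> - \<Phi>\<^sup>2 * tail (real L)"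
      unfolding \<Phi>\<eta> \<mu>_def by linarith
    then have "2 * n * (\<mu> / 2) \<le> 2 * n * (- lam * \<phi>0\<^sup>2 - \<Phi>\<^sup>2 * \<eta> - \<Phi>\<^sup>2 * tail (real L))"
      using n(1) by (intro mult_left_mono) auto
    then have "1 \<le> 2 * n * (- lam * \<phi>0\<^sup>2 - \<Phi>\<^sup>2 * \<eta> - \<Phi>\<^sup>2 * tail (real L)) - 2 * real L * \<Phi>\<^sup>2"
      using n(2) by simp
    also have "\<dots> \<le> \<Phi>\<^sup>2 * D * (LINT x|lborel. indicator {z - n..z + n} x * u x)"
      by (rule integral_lower_bound[OF su lam \<eta> D _ n(1) c]) auto
    finally show ?thesis using \<Phi>_pos D(1) by (simp add: field_simps)
  qed
  obtain h where h: "h > 0" "\<And>z. h * (LINT x|lborel. indicator {z - n..z + n} x * u x) \<le> window u z"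
    using integral_le_window[OF u(2) C] by blast
  have "h * (1 / (\<Phi>\<^sup>2 * D)) \<le> window u z" for z
    using mult_left_mono[OF mass[of z], of h] h by (auto intro: order_trans)
  then have "k * (h * (1 / (\<Phi>\<^sup>2 * D))) \<le> k * window u x" for x
    using k(1) by (intro mult_left_mono) auto
  then have "AE x in lborel. k * (h * (1 / (\<Phi>\<^sup>2 * D))) \<le> u x"
    using k(2) by (auto elim!: eventually_mono intro: order_trans)
  moreover have "k * (h * (1 / (\<Phi>\<^sup>2 * D))) > 0" using k h D \<Phi>_pos by simp
  ultimately show ?thesis using that by blast
qed

lemma solution_unique:
  assumes "solution B u" "solution B' v" "lam < 0"
    "\<not> (AE x in lborel. u x = 0)" "\<not> (AE x in lborel. v x = 0)"
  shows "AE x in lborel. u x = v x"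
proof -
  obtain c where c: "c > 0" "AE x in lborel. c \<le> u x" using solution_lower_bound assms by blast
  obtain d where d: "d > 0" "AE x in lborel. d \<le> v x" using solution_lower_bound assms by blast
  show ?thesis
    using solution_le[OF assms(1,2) d] solution_le[OF assms(2,1) c] by eventually_elim simp
qed

end

section \<open>The periodic solution\<close>

context kpp_reaction
begin

text \<open>Since \<open>f x v / v\<close> decreases, \<open>v - f x v\<close> is increasing wherever it is positive, so it is
  inverted by \<open>resolvent M x\<close> at \<open>c > 0\<close>; at \<open>c = 0\<close> the largest root is taken.\<close>

definition resolvent :: "real \<Rightarrow> real \<Rightarrow> real \<Rightarrow> real" where
  "resolvent M x c = Sup {v \<in> {0..M}. v - f x v \<le> c}"

context
  fixes M c x :: real
  assumes M: "M > 0" "f x M \<le> 0" and c: "0 \<le> c" "c \<le> M"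
begin

lemma resolvent_in: "resolvent M x c \<in> {v \<in> {0..M}. v - f x v \<le> c}"
proof -
  have "continuous_on {0..M} (\<lambda>v. v - f x v)"
    by (intro continuous_on_diff f_continuous continuous_intros) auto
  then have "closed ({0..M} \<inter> (\<lambda>v. v - f x v) -` {..c})"
    by (intro continuous_closed_preimage) auto
  also have "{0..M} \<inter> (\<lambda>v. v - f x v) -` {..c} = {v \<in> {0..M}. v - f x v \<le> c}" by auto
  finally show ?thesis
    unfolding resolvent_def using c M f_zero
    by (intro closed_contains_Sup) (auto intro!: bdd_aboveI[of _ M] exI[of _ 0])
qed

lemma resolvent_bounds: "0 \<le> resolvent M x c" "resolvent M x c \<le> M"
  using resolvent_in by auto

lemma le_resolvent: "0 \<le> v \<Longrightarrow> v \<le> M \<Longrightarrow> v - f x v \<le> c \<Longrightarrow> v \<le> resolvent M x c"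
  unfolding resolvent_def by (intro cSup_upper) (auto intro!: bdd_aboveI[of _ M])

text \<open>At \<open>M\<close> the function v - f(x,v) is at least M \<ge> c, so the value
  \<open>c\<close> is taken at some point not below the resolvent; by maximality that point is the
  resolvent.\<close>

lemma resolvent_eq: "resolvent M x c - f x (resolvent M x c) = c"
proof -
  let ?G = "resolvent M x c"
  have "continuous_on {?G..M} (\<lambda>v. v - f x v)"
    using resolvent_bounds by (intro continuous_on_diff f_continuous continuous_intros) auto
  then obtain v where v: "?G \<le> v" "v \<le> M" "v - f x v = c"
    using IVT'[of "\<lambda>v. v - f x v" ?G c M] resolvent_in M c by auto
  then have "v \<le> ?G" using resolvent_bounds by (intro le_resolvent) auto
  with v show ?thesis by simp
qed

text \<open>Below the resolvent G, strict decrease of the rate gives v - f(x,v) \<le> v c/G \<le> c.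
  The equivalence describes superlevel sets explicitly, which makes the iterates Borel
  measurable.\<close>

lemma le_resolvent_iff:
  assumes v: "0 < v" "v \<le> M"
  shows "v \<le> resolvent M x c \<longleftrightarrow> v - f x v \<le> c"
proof
  assume le: "v \<le> resolvent M x c"
  show "v - f x v \<le> c"
  proof (cases "v = resolvent M x c")
    case True
    then show ?thesis using resolvent_eq by simp
  next
    case False
    let ?G = "resolvent M x c"
    have G: "v < ?G" using le False by simp
    then have "f x ?G / ?G < f x v / v" by (rule f_decreasing[OF v(1)])
    then have "v * (1 - f x v / v) \<le> v * (1 - f x ?G / ?G)"
      using v by (intro mult_left_mono) auto
    also have "1 - f x ?G / ?G = c / ?G" using resolvent_eq G v by (simp add: field_simps)
    also have "v * (c / ?G) \<le> c"
      using mult_left_mono[OF le c(1)] G v by (simp add: field_simps)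
    finally show ?thesis using v by (simp add: right_diff_distrib)
  qed
qed (use v le_resolvent in auto)

end

lemma resolvent_mono:
  assumes "M > 0" "f x M \<le> 0" "0 \<le> c" "c \<le> c'" "c' \<le> M"
  shows "resolvent M x c \<le> resolvent M x c'"
proof -
  have cc: "c \<le> M" "0 \<le> c'" using assms by auto
  show ?thesis
    using resolvent_in[OF assms(1,2,3) cc(1)] assms(4)
    by (intro le_resolvent[OF assms(1,2) cc(2) assms(5)]) auto
qed

end

context kpp_eigenpair
begin

text \<open>At densities up to \<open>d\<close> the deficit is at most \<open>- lam\<close>, so 1 -
  f(x,v)/v is at most the eigenvalue quotient (J*\<phi>)/\<phi>.\<close>

lemma small_multiple_subsolution:
  assumes "lam < 0" "M > 0"
  obtains \<epsilon> where "\<epsilon> > 0" "\<epsilon> * \<Phi> \<le> M"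
    "\<And>x. \<epsilon> * \<phi> x - f x (\<epsilon> * \<phi> x) \<le> convolution J (\<lambda>y. \<epsilon> * \<phi> y) x"
proof -
  obtain d where d: "d > 0" "\<And>x v. 0 < v \<Longrightarrow> v \<le> d \<Longrightarrow> deficit x v \<le> - lam"
    using deficit_small[of "- lam"] assms(1) by auto
  define \<epsilon> where "\<epsilon> = min M d / \<Phi>"
  have \<epsilon>: "\<epsilon> > 0" "\<epsilon> * \<Phi> \<le> M" "\<epsilon> * \<Phi> \<le> d"
    using d \<Phi>_pos assms(2) by (auto simp: \<epsilon>_def)
  show ?thesis
  proof (rule that[OF \<epsilon>(1,2)])
    fix x
    have pos: "\<epsilon> * \<phi> x > 0" using \<epsilon> \<phi>_pos by simp
    have "\<epsilon> * \<phi> x \<le> \<epsilon> * \<Phi>" using \<epsilon> profileD(3)[OF \<phi>, of x] by (intro mult_left_mono) auto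
    then have "deficit x (\<epsilon> * \<phi> x) \<le> - lam" using d(2)[OF pos] \<epsilon>(3) by simp
    then have "1 - f x (\<epsilon> * \<phi> x) / (\<epsilon> * \<phi> x) \<le> 1 - fu x 0 - lam" by (simp add: deficit_def)
    from mult_left_mono[OF this less_imp_le[OF pos]] pos
    have "\<epsilon> * \<phi> x - f x (\<epsilon> * \<phi> x) \<le> \<epsilon> * \<phi> x * (1 - fu x 0 - lam)"
      by (simp only: right_diff_distrib nonzero_mult_div_cancel_left mult_1_right
          times_divide_eq_right less_imp_neq[OF pos, symmetric] not_False_eq_True)
    then show "\<epsilon> * \<phi> x - f x (\<epsilon> * \<phi> x) \<le> convolution J (\<lambda>y. \<epsilon> * \<phi> y) x"
      by (simp add: convolution_cmult[OF \<phi>] eigen algebra_simps)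
  qed
qed

lemma periodic_solution_exists:
  assumes lam: "lam < 0" and M: "M > 0" "\<And>x. f x M \<le> 0"
  obtains p where "profile M p" "periodic (2 * R) p" "\<And>x. 0 < p x"
    "\<And>x. convolution J p x = p x - f x (p x)"
proof -
  obtain \<epsilon> where \<epsilon>: "\<epsilon> > 0" "\<epsilon> * \<Phi> \<le> M"
    "\<And>x. \<epsilon> * \<phi> x - f x (\<epsilon> * \<phi> x) \<le> convolution J (\<lambda>y. \<epsilon> * \<phi> y) x"
    using small_multiple_subsolution[OF lam M(1)] by blast
  have e\<phi>M: "\<epsilon> * \<phi> x \<le> M" for x
    using \<epsilon> profileD(3)[OF \<phi>, of x] by (intro order_trans[OF mult_left_mono \<epsilon>(2)]) auto
  have e\<phi>: "profile M (\<lambda>x. \<epsilon> * \<phi> x)"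
    using profileD[OF \<phi>] \<epsilon> e\<phi>M by (auto simp: profile_def)
  \<comment> \<open>Monotone iteration from the constant supersolution \<open>M\<close>: each
    iterate solves the equation with the convolution of its predecessor as right-hand side.\<close>
  define p where "p = rec_nat (\<lambda>_. M) (\<lambda>_ q x. resolvent M x (convolution J q x))"
  have p0: "p 0 = (\<lambda>_. M)" and pS: "p (Suc k) = (\<lambda>x. resolvent M x (convolution J (p k) x))" for k
    by (simp_all add: p_def)
  have prof: "profile M (p k)" for k
  proof (induction k)
    case 0
    then show ?case using M by (simp add: p0 profile_def)
  next
    case (Suc k)
    note cv = convolution_nonneg[OF Suc] convolution_le[OF Suc]
    note [measurable] = convolution_measurable[OF Suc]
    have "{x. a \<le> p (Suc k) x} \<in> sets borel" for a
    proof -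
      consider "a \<le> 0" | "a > M" | "0 < a" "a \<le> M" by linarith
      then show ?thesis
      proof cases
        case 1
        then have "{x. a \<le> p (Suc k) x} = UNIV"
          using resolvent_bounds(1)[OF M cv] by (auto simp: pS intro: order_trans)
        then show ?thesis by simp
      next
        case 2
        then have "{x. a \<le> p (Suc k) x} = {}"
          using resolvent_bounds(2)[OF M cv] by (auto simp: pS not_le intro: order_le_less_trans)
        then show ?thesis by simp
      next
        case 3
        then have [measurable]: "(\<lambda>x. f x a) \<in> borel_measurable borel"
          by (intro borel_measurable_continuous_onI f_continuous continuous_intros) auto
        have "{x. a \<le> p (Suc k) x} = {x. a - f x a \<le> convolution J (p k) x}"
          using le_resolvent_iff[OF M cv 3] by (simp add: pS)
        also have "\<dots> \<in> sets borel" by measurable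
        finally show ?thesis .
      qed
    qed
    then have "p (Suc k) \<in> borel_measurable borel" by (simp add: borel_measurable_iff_ge)
    then show ?case using resolvent_bounds[OF M cv] by (simp add: profile_def pS)
  qed
  note cv = convolution_nonneg[OF prof] convolution_le[OF prof]
  \<comment> \<open>The subsolution stays below every iterate because the resolvent is the largest
    admissible value and convolution is monotone. This keeps the limit positive.\<close>
  have lower: "\<epsilon> * \<phi> x \<le> p k x" for k x
  proof (induction k arbitrary: x)
    case 0
    then show ?case using e\<phi>M by (simp add: p0)
  next
    case (Suc k)
    have "convolution J (\<lambda>y. \<epsilon> * \<phi> y) x \<le> convolution J (p k) x"
      using Suc by (intro convolution_mono[OF e\<phi> prof]) auto
    then show ?case
      unfolding pS using \<epsilon>(3)[of x] profileD(2)[OF e\<phi>] e\<phi>M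
      by (intro le_resolvent[OF M cv]) auto
  qed
  have dec: "p (Suc k) x \<le> p k x" for k x
  proof (induction k arbitrary: x)
    case 0
    then show ?case using profileD(3)[OF prof] by (simp add: p0)
  next
    case (Suc k)
    have "convolution J (p (Suc k)) x \<le> convolution J (p k) x"
      using Suc by (intro convolution_mono[OF prof prof]) auto
    then show ?case
      using resolvent_mono[OF M cv(1)[of "Suc k" x] _ cv(2)[of k x]] by (simp add: pS)
  qed
  have per: "periodic (2 * R) (p k)" for k
  proof (induction k)
    case 0
    then show ?case by (simp add: p0 periodic_def)
  next
    case (Suc k)
    have "convolution J (p k) (x + 2 * R) = convolution J (p k) x" for x
      using Suc convolution_shift[OF prof, of k x "2 * R"] by (simp add: periodic_def)
    moreover have "v \<ge> 0 \<Longrightarrow> f (x + 2 * R) v = f x v" for x v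
      using f_periodic by (simp add: periodic_def)
    ultimately show ?case
      unfolding periodic_def pS resolvent_def by (auto intro!: arg_cong[of _ _ Sup])
  qed
  define q where "q x = (INF k. p k x)" for x
  have lim: "(\<lambda>k. p k x) \<longlonglongrightarrow> q x" for x
    unfolding q_def
    by (intro LIMSEQ_decseq_INF decseq_SucI dec) (auto intro!: bdd_belowI2[of _ 0] profileD(2)[OF prof])
  have q_bd: "\<epsilon> * \<phi> x \<le> q x" "q x \<le> M" for x
    using LIMSEQ_le_const[OF lim] LIMSEQ_le_const2[OF lim] lower profileD(3)[OF prof] by blast+
  have q_pos: "0 < q x" for x
    using q_bd(1)[of x] \<epsilon>(1) \<phi>_pos[of x] by (meson less_le_trans mult_pos_pos)
  have "q \<in> borel_measurable borel"
    by (rule borel_measurable_LIMSEQ_real[OF lim profileD(1)[OF prof]])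
  then have q: "profile M q"
    using q_bd q_pos by (simp add: profile_def less_imp_le)
  \<comment> \<open>Both sides are limits of the same sequence; the shift to \<open>Suc k\<close>
    pairs each iterate with the convolution of its predecessor.\<close>
  have "convolution J q x = q x - f x (q x)" for x
  proof (rule LIMSEQ_unique)
    show "(\<lambda>k. convolution J (p k) x) \<longlonglongrightarrow> convolution J q x"
      by (rule convolution_tendsto[OF prof lim])
    have "continuous_on {0..} (f x)" by (intro f_continuous continuous_intros) auto
    then have "(\<lambda>k. f x (p (Suc k) x)) \<longlonglongrightarrow> f x (q x)"
      using q_pos[of x] profileD(2)[OF prof]
      by (rule_tac continuous_on_tendsto_compose[OF _ LIMSEQ_Suc[OF lim]]) (auto simp: less_imp_le)
    then have "(\<lambda>k. p (Suc k) x - f x (p (Suc k) x)) \<longlonglongrightarrow> q x - f x (q x)"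
      by (intro tendsto_diff LIMSEQ_Suc[OF lim])
    moreover have "p (Suc k) x - f x (p (Suc k) x) = convolution J (p k) x" for k
      unfolding pS by (rule resolvent_eq[OF M cv])
    ultimately show "(\<lambda>k. convolution J (p k) x) \<longlonglongrightarrow> q x - f x (q x)" by simp
  qed
  moreover have "periodic (2 * R) q"
    using per by (simp add: periodic_def q_def)
  ultimately show ?thesis using that q q_pos by blast
qed

end

text \<open>A Borel version is clipped to \<open>{0..B}\<close> so that its bounds hold everywhere.
  Convolution ignores null sets, so the equation survives almost everywhere.\<close>

lemma (in kpp_dispersal) solution_borel_version:
  assumes "nonneg_bounded_solution J f u"
  obtains B w where "solution B w" "AE x in lborel. u x = w x"
proof -
  have u [measurable]: "u \<in> borel_measurable lebesgue" and u0: "\<And>x. 0 \<le> u x"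
    and eq: "AE x in lborel. dispersal J u x + f x (u x) = 0"
    using assms by (auto simp: nonneg_bounded_solution_def AE_completion_iff)
  obtain B where B: "B > 0" "\<And>x. \<bar>u x\<bar> \<le> B"
    using assms by (auto simp: nonneg_bounded_solution_def bounded_pos)
  obtain g where g: "g \<in> borel_measurable lborel" "AE x in lborel. u x = g x"
    using completion_ex_borel_measurable_real[OF u] by auto
  define w where "w x = max 0 (min B (g x))" for x
  have w: "profile B w"
    using g(1) B(1) unfolding profile_def w_def by auto
  have uw: "AE x in lborel. u x = w x"
    using g(2) by eventually_elim (use u0 B(2) in \<open>metis abs_le_D1 max.absorb2 min.absorb2 w_def\<close>)
  have [measurable]: "w \<in> borel_measurable lebesgue" "(\<lambda>y. J (x - y)) \<in> borel_measurable lebesgue" for x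
    using profileD(1)[OF w] by (intro measurable_completion; measurable)+
  have conv: "convolution J u x = convolution J w x" for x
    unfolding convolution_def
  proof (rule integral_cong_AE)
    show "AE y in lebesgue. J (x - y) * u y = J (x - y) * w y"
      using AE_completion[OF uw] by eventually_elim simp
  qed measurable
  have "AE x in lborel. convolution J w x = w x - f x (w x)"
    using eq uw by eventually_elim (simp add: dispersal_def conv)
  then show ?thesis using that w B uw by (auto simp: solution_def)
qed

theorem theorem1p3:
  fixes R lam :: real
    and J u :: "real \<Rightarrow> real"
    and f fu :: "real \<Rightarrow> real \<Rightarrow> real"
  assumes R_pos: "R > 0"
    and J_cont: "continuous_on UNIV J"
    and J_nonneg: "\<And>x. J x \<ge> 0"
    and J_integrable: "integrable lebesgue J"
    and J_integral: "(LINT x|lebesgue. J x) = 1"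
    and J_supp: "\<exists>a b. a < 0 \<and> 0 < b \<and> J a > 0 \<and> J b > 0"
    and J_sym: "\<And>x. J (- x) = J x"
    and f_cont: "continuous_on (UNIV \<times> {0..}) (\<lambda>(x, v). f x v)"
    and f_deriv: "\<And>x v. v \<ge> 0 \<Longrightarrow> (f x has_real_derivative fu x v) (at v within {0..})"
    and f_periodic: "\<And>v. v \<ge> 0 \<Longrightarrow> periodic (2 * R) (\<lambda>x. f x v)"
    and fu_lipschitz: "\<exists>L. L-lipschitz_on UNIV (\<lambda>x. fu x 0)"
    and f_zero: "\<And>x. f x 0 = 0"
    and f_decreasing: "\<And>x v w. 0 < v \<Longrightarrow> v < w \<Longrightarrow> f x w / w < f x v / v"
    and f_nonpos: "\<exists>M>0. \<forall>x. \<forall>v\<ge>M. f x v \<le> 0"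
    and u_solution: "nonneg_bounded_solution J f u"
    and lam_principal: "is_principal_eigenvalue R J (\<lambda>x. fu x 0) lam"
  shows "(lam < 0 \<longrightarrow>
            (\<exists>p. positive_periodic_solution R J f p) \<and>
            (\<forall>p. positive_periodic_solution R J f p \<longrightarrow>
               (AE x in lebesgue. u x = 0) \<or> (AE x in lebesgue. u x = p x))) \<and>
         (lam \<ge> 0 \<longrightarrow> (AE x in lebesgue. u x = 0))"
proof -
  obtain L where "L-lipschitz_on UNIV (\<lambda>x. fu x 0)" using fu_lipschitz by blast
  then have fu_cont: "continuous_on UNIV (\<lambda>x. fu x 0)" by (rule lipschitz_on_continuous_on)
  have J_meas: "J \<in> borel_measurable lborel"
    using J_cont by (simp add: borel_measurable_continuous_onI)
  have "integrable lborel J" "(LINT x|lborel. J x) = 1"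
    using J_integrable J_integral integrable_completion[OF J_meas] integral_completion[OF J_meas]
    by simp_all
  then interpret kpp_dispersal R f fu J
    using R_pos J_cont J_nonneg J_supp J_sym f_cont f_deriv f_periodic f_zero f_decreasing fu_cont
    by unfold_locales auto
  obtain \<phi> where \<phi>: "continuous_on UNIV \<phi>" "periodic (2 * R) \<phi>" "\<And>x. 0 < \<phi> x"
    "\<And>x. dispersal J \<phi> x + fu x 0 * \<phi> x = - lam * \<phi> x"
    using lam_principal unfolding is_principal_eigenvalue_def C_per_def by auto
  have "2 * R > 0" using R_pos by simp
  then obtain \<Phi> where \<Phi>: "\<Phi> > 0" "\<And>x. \<bar>\<phi> x\<bar> \<le> \<Phi>"
    using periodic_upper_bound[of "2 * R" \<phi>] \<phi>(1,2) by blast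
  \<comment> \<open>A dummy second variable ranging over one point brings the positive minimum of
    the eigenfunction under \<open>periodic_lower_bound\<close>.\<close>
  have "continuous_on (UNIV \<times> {0::real}) (\<lambda>(x, v). \<phi> x)"
    unfolding case_prod_unfold by (intro continuous_on_compose2[OF \<phi>(1)] continuous_intros) auto
  then obtain \<phi>0 where \<phi>0: "\<phi>0 > 0" "\<And>x v. v \<in> {0::real} \<Longrightarrow> \<phi>0 \<le> \<phi> x"
    by (rule periodic_lower_bound[of "2 * R" "{0::real}" "\<lambda>x v. \<phi> x", rotated 2])
       (use R_pos \<phi> in auto)
  interpret kpp_eigenpair R f fu J lam \<phi>0 \<Phi> \<phi>
  proof
    show "profile \<Phi> \<phi>"
      using \<phi>(1,3) \<Phi> by (auto simp: profile_def abs_le_iff less_imp_le intro: borel_measurable_continuous_onI)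
    show "convolution J \<phi> x = (1 - fu x 0 - lam) * \<phi> x" for x
      using \<phi>(4)[of x] by (simp add: dispersal_def algebra_simps)
  qed (use \<phi> \<phi>0 in auto)
  obtain B w where w: "solution B w" "AE x in lborel. u x = w x"
    using solution_borel_version[OF u_solution] .
  obtain M where M: "M > 0" "\<And>x. f x M \<le> 0" using f_nonpos by auto
  have "\<exists>p. positive_periodic_solution R J f p" if lam: "lam < 0"
  proof -
    obtain p where p: "profile M p" "periodic (2 * R) p" "\<And>x. 0 < p x"
      "\<And>x. convolution J p x = p x - f x (p x)"
      using periodic_solution_exists[OF lam M] by blast
    have "p \<in> borel_measurable lebesgue"
      using profileD(1)[OF p(1)] by (intro measurable_completion) simp
    moreover have "bounded (range p)"
      using profileD(2,3)[OF p(1)] by (auto intro!: boundedI[of _ M])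
    ultimately show ?thesis
      using p by (auto simp: positive_periodic_solution_def nonneg_bounded_solution_def
          dispersal_def less_imp_le)
  qed
  moreover have "(AE x in lebesgue. u x = 0) \<or> (AE x in lebesgue. u x = p x)"
    if lam: "lam < 0" and p: "positive_periodic_solution R J f p" for p
  proof -
    obtain B' q where q: "solution B' q" "AE x in lborel. p x = q x"
      using solution_borel_version p unfolding positive_periodic_solution_def by blast
    \<comment> \<open>\<open>p\<close> is positive everywhere, so if its version \<open>q\<close>
      vanished almost everywhere the whole line would be null.\<close>
    have "\<not> (AE x in lborel. q x = 0)"
    proof
      assume "AE x in lborel. q x = 0"
      with q(2) have "AE x in (lborel :: real measure). False"
        by eventually_elim (use p in \<open>auto simp: positive_periodic_solution_def less_le\<close>)
      then show False by (simp add: AE_iff_measurable[OF _ refl])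
    qed
    then have "(AE x in lborel. w x = 0) \<or> (AE x in lborel. w x = q x)"
      using solution_unique[OF w(1) q(1) lam] by blast
    then have "(AE x in lborel. u x = 0) \<or> (AE x in lborel. u x = p x)"
    proof
      assume "AE x in lborel. w x = 0"
      with w(2) have "AE x in lborel. u x = 0" by eventually_elim simp
      then show ?thesis ..
    next
      assume "AE x in lborel. w x = q x"
      with w(2) q(2) have "AE x in lborel. u x = p x" by eventually_elim simp
      then show ?thesis ..
    qed
    then show ?thesis by (simp only: AE_completion_iff)
  qed
  moreover have "AE x in lebesgue. u x = 0" if "lam \<ge> 0"
    unfolding AE_completion_iff using w(2) solution_zero[OF w(1) that] by eventually_elim simp
  ultimately show ?thesis by blast
qed

end
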